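(* Let $\tilde M$ be a Kenmotsu manifold with structure $(\phi,\xi,\eta,g)$, and let $M=N_T\times_f N_\theta$ be a warped product semi-slant submanifold of $\tilde M$ such that $\xi\in TN_T$, where $N_T$ is an invariant submanifold of $\tilde M$ and $N_\theta$ is a proper slant submanifold of $\tilde M$. Then for all $X\in TN_T$ and $Z\in TN_\theta$, the normal vector field $(\tilde\nabla_X N)Z$ lies in the invariant normal subbundle $\mu$, i.e. in the orthogonal complement of $N(TN_\theta)$ in $T^\perp M$.
   Context: An almost contact metric structure on a $(2n+1)$-dimensional smooth manifold $\tilde M$ is $(\phi,\xi,\eta,g)$ with $\phi$ a $(1,1)$-tensor field, $\xi$ a vector field, $\eta$ a 1-form and $g$ a Riemannian metric such that $\phi^2=-I+\eta\otimes\xi$, $\eta(\xi)=1$, $\eta\circ\phi=0$, $\phi\xi=0$, $g(X,Y)=g(\phi X,\phi Y)+\eta(X)\eta(Y)$, $g(X,\phi Y)=-g(\phi X,Y)$, $g(X,\xi)=\eta(X)$. It is Kenmotsu if $(\tilde\nabla_X\phi)Y=g(\phi X,Y)\xi-\eta(Y)\phi X$ for all $X,Y\in T\tilde M$, where $\tilde\nabla$ is the Levi-Civita connection of $g$. For a submanifold $M$ of $\tilde M$ (with induced metric, also denoted $g$), $\nabla$ is the induced Levi-Civita connection, $T^\perp M$ the normal bundle and $\nabla^\perp$ the normal connection. For $X\in TM$ write $\phi X=TX+NX$ with $TX\in TM$ and $NX\in T^\perp M$. The covariant derivative of $N$ is $(\tilde\nabla_X N)Y=\nabla^\perp_X(NY)-N(\nabla_XY)$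 for $X,Y\in TM$. Throughout, $\xi$ is tangent to $M$. A submanifold $P$ of $\tilde M$ is invariant if $\phi(TP)\subseteq TP$. It is slant if the angle between $\phi X$ and the tangent space of $P$ is a constant $\theta$ (the slant angle) for all nonzero tangent vectors $X$ of $P$ not proportional to $\xi$; it is proper slant if $\theta\neq 0,\pi/2$. The warped product $N_1\times_f N_2$ of Riemannian manifolds $(N_1,g_1)$, $(N_2,g_2)$, with $f$ a positive differentiable function on $N_1$, is $N_1\times N_2$ with metric $g_1+f^2g_2$. A warped product submanifold of $\tilde M$ is a submanifold whose induced metric is such a warped product metric; $TN_1$ and $TN_2$ are regarded as subbundles of $TM$. A semi-slant submanifold is one with an orthogonal decomposition $TM=D_1\oplus D_2\oplus\{\xi\}$ where $\phi(D_1)=D_1$ and $D_2$ is slant with slant angle $\theta\neq0$ (the angle between $\phi X$ and $D_2$ is the constant $\theta$ for nonzero $X\in D_2$); then $T^\perp M=ND_2\oplus\mu$, where $\mu$, the orthogonal complement of $ND_2$ in $T^\perp M$, is called the invariant normal subbundle. Here $TN_T=D_1\oplus\{\xi\}$ and $TN_\theta=D_2$. *)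

theory Defs
  imports "HOL-Analysis.Analysis"
begin

subsection \<open>Smooth maps between Euclidean spaces\<close>

text \<open>For open \<open>S\<close>: \<open>f\<close> is \<open>k\<close> times continuously differentiable on \<open>S\<close>.\<close>

primrec Ck_on :: "nat \<Rightarrow> ('a::euclidean_space \<Rightarrow> 'b::euclidean_space) \<Rightarrow> 'a set \<Rightarrow> bool" where
  "Ck_on 0 f S \<longleftrightarrow> continuous_on S f"
| "Ck_on (Suc k) f S \<longleftrightarrow> (\<forall>x\<in>S. f differentiable (at x)) \<and>
     (\<forall>v. Ck_on k (\<lambda>x. frechet_derivative f (at x) v) S)"

definition smooth_on :: "('a::euclidean_space \<Rightarrow> 'b::euclidean_space) \<Rightarrow> 'a set \<Rightarrow> bool" where
  "smooth_on f S \<longleftrightarrow> (\<forall>k. Ck_on k f S)"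

definition smooth_near :: "('a::euclidean_space \<Rightarrow> 'b::euclidean_space) \<Rightarrow> 'a \<Rightarrow> bool" where
  "smooth_near f x \<longleftrightarrow> (\<exists>W. open W \<and> x \<in> W \<and> smooth_on f W)"


subsection \<open>Smooth manifolds\<close>

text \<open>
  A chart is a pair of an open domain and a coordinate map. A smooth manifold is a Hausdorff,
  second countable type (sort constraint of the point type in the theorem) together with an atlas
  indexed by the points: \<open>c p\<close> is a chart around \<open>p\<close>. Choosing one chart around every point
  of a given smooth manifold yields such an atlas of the same smooth structure. The choice also fixes
  an isomorphism between the tangent space at \<open>p\<close> and the model space \<open>'e\<close>, namely the components
  with respect to the chart \<open>c p\<close>. Hence, throughout, a tangent vector at \<open>p\<close> is an element of \<open>'e\<close>,
  a vector field is a function \<open>'m \<Rightarrow> 'e\<close>, a (1,1)-tensor field is a function \<open>'m \<Rightarrow> 'e \<Rightarrow> 'e\<close>,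
  and so on; the value at \<open>p\<close> always refers to the chart \<open>c p\<close>.
\<close>

type_synonym ('m, 'e) pointed_atlas = "'m \<Rightarrow> 'm set \<times> ('m \<Rightarrow> 'e)"

definition cdom :: "('m, 'e) pointed_atlas \<Rightarrow> 'm \<Rightarrow> 'm set" where
  "cdom c p = fst (c p)"

definition cmap :: "('m, 'e) pointed_atlas \<Rightarrow> 'm \<Rightarrow> 'm \<Rightarrow> 'e" where
  "cmap c p = snd (c p)"

definition cinv :: "('m, 'e) pointed_atlas \<Rightarrow> 'm \<Rightarrow> 'e \<Rightarrow> 'm" where
  "cinv c p = inv_into (cdom c p) (cmap c p)"

definition smooth_atlas ::
    "('m::topological_space, 'e::euclidean_space) pointed_atlas \<Rightarrow> bool" where
  "smooth_atlas c \<longleftrightarrow>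
     (\<forall>p. p \<in> cdom c p \<and> open (cdom c p) \<and> open (cmap c p ` cdom c p) \<and>
        homeomorphism (cdom c p) (cmap c p ` cdom c p) (cmap c p) (cinv c p)) \<and>
     (\<forall>p q. smooth_on (cmap c q \<circ> cinv c p) (cmap c p ` (cdom c p \<inter> cdom c q)))"

definition prod_atlas ::
    "('a, 'ea) pointed_atlas \<Rightarrow> ('b, 'eb) pointed_atlas \<Rightarrow> ('a \<times> 'b, 'ea \<times> 'eb) pointed_atlas"
  where
  "prod_atlas c1 c2 = (\<lambda>(p, q). (cdom c1 p \<times> cdom c2 q, map_prod (cmap c1 p) (cmap c2 q)))"

text \<open>\<open>tcoord_change c a b q\<close> turns the components of a tangent vector at \<open>q\<close> with respect
  to the chart \<open>c a\<close> into its components with respect to the chart \<open>c b\<close>.\<close>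

definition tcoord_change ::
    "('m, 'e::euclidean_space) pointed_atlas \<Rightarrow> 'm \<Rightarrow> 'm \<Rightarrow> 'm \<Rightarrow> 'e \<Rightarrow> 'e" where
  "tcoord_change c a b q = frechet_derivative (cmap c b \<circ> cinv c a) (at (cmap c a q))"

definition mdiff :: "('a, 'd::euclidean_space) pointed_atlas \<Rightarrow>
    ('m, 'e::euclidean_space) pointed_atlas \<Rightarrow> ('a \<Rightarrow> 'm) \<Rightarrow> 'a \<Rightarrow> 'd \<Rightarrow> 'e" where
  "mdiff cP c F p = frechet_derivative (cmap c (F p) \<circ> F \<circ> cinv cP p) (at (cmap cP p p))"

definition smooth_map :: "('a::topological_space, 'd::euclidean_space) pointed_atlas \<Rightarrow>
    ('m::topological_space, 'e::euclidean_space) pointed_atlas \<Rightarrow> ('a \<Rightarrow> 'm) \<Rightarrow> bool" where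
  "smooth_map cP c F \<longleftrightarrow> continuous_on UNIV F \<and>
     (\<forall>p. smooth_near (cmap c (F p) \<circ> F \<circ> cinv cP p) (cmap cP p p))"

definition smooth_fun :: "('m, 'e::euclidean_space) pointed_atlas \<Rightarrow> ('m \<Rightarrow> real) \<Rightarrow> bool" where
  "smooth_fun c f \<longleftrightarrow> (\<forall>p. smooth_near (f \<circ> cinv c p) (cmap c p p))"

text \<open>A vector field along \<open>F\<close> assigns to \<open>y\<close> a tangent vector at \<open>F y\<close>; ordinary vector fields are
  vector fields along the identity. \<open>field_rep\<close> is its coordinate representation near \<open>p\<close>
  with respect to the charts around \<open>p\<close> and \<open>F p\<close>.\<close>

definition field_rep :: "('a, 'd::euclidean_space) pointed_atlas \<Rightarrow>
    ('m, 'e::euclidean_space) pointed_atlas \<Rightarrow> ('a \<Rightarrow> 'm) \<Rightarrow> ('a \<Rightarrow> 'e) \<Rightarrow> 'a \<Rightarrow> 'd \<Rightarrow> 'e" where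
  "field_rep cP c F V p =
     (\<lambda>x. let y = cinv cP p x in tcoord_change c (F y) (F p) (F y) (V y))"

definition smooth_field_at ::
    "('m, 'e::euclidean_space) pointed_atlas \<Rightarrow> ('m \<Rightarrow> 'e) \<Rightarrow> 'm \<Rightarrow> bool" where
  "smooth_field_at c V p \<longleftrightarrow> smooth_near (field_rep c c (\<lambda>q. q) V p) (cmap c p p)"

definition smooth_vector_field ::
    "('m, 'e::euclidean_space) pointed_atlas \<Rightarrow> ('m \<Rightarrow> 'e) \<Rightarrow> bool" where
  "smooth_vector_field c V \<longleftrightarrow> (\<forall>p. smooth_field_at c V p)"

definition smooth_one_form ::
    "('m, 'e::euclidean_space) pointed_atlas \<Rightarrow> ('m \<Rightarrow> 'e \<Rightarrow> real) \<Rightarrow> bool" where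
  "smooth_one_form c \<eta> \<longleftrightarrow> (\<forall>p. linear (\<eta> p)) \<and>
     (\<forall>p v. smooth_near
        (\<lambda>x. let q = cinv c p x in \<eta> q (tcoord_change c p q q v)) (cmap c p p))"

definition smooth_endomorphism_field ::
    "('m, 'e::euclidean_space) pointed_atlas \<Rightarrow> ('m \<Rightarrow> 'e \<Rightarrow> 'e) \<Rightarrow> bool" where
  "smooth_endomorphism_field c \<phi> \<longleftrightarrow> (\<forall>p. linear (\<phi> p)) \<and>
     (\<forall>p v. smooth_near
        (\<lambda>x. let q = cinv c p x in tcoord_change c q p q (\<phi> q (tcoord_change c p q q v)))
        (cmap c p p))"

definition riemannian_metric ::
    "('m, 'e::euclidean_space) pointed_atlas \<Rightarrow> ('m \<Rightarrow> 'e \<Rightarrow> 'e \<Rightarrow> real) \<Rightarrow> bool" where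
  "riemannian_metric c g \<longleftrightarrow>
     (\<forall>p. bilinear (g p) \<and> (\<forall>u v. g p u v = g p v u) \<and> (\<forall>v. v \<noteq> 0 \<longrightarrow> g p v v > 0)) \<and>
     (\<forall>p u v. smooth_near
        (\<lambda>x. let q = cinv c p x in g q (tcoord_change c p q q u) (tcoord_change c p q q v))
        (cmap c p p))"


subsection \<open>The Levi-Civita connection\<close>

text \<open>
  A linear connection is given by its Christoffel maps: \<open>\<Gamma> p\<close> is the bilinear map of the
  Christoffel symbols at \<open>p\<close> with respect to the chart \<open>c p\<close>. \<open>covd_along\<close> is the induced
  covariant derivative, in the direction \<open>u\<close> at \<open>p\<close>, of a vector field \<open>V\<close> along a map \<open>F\<close>
  (the derivative of the components plus \<open>\<Gamma>(dF(u), V)\<close>). If \<open>V\<close> is the restriction to \<open>F\<close> of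
  a vector field on the target, this is the ambient derivative of any extension in direction \<open>dF(u)\<close>.
\<close>

definition covd_along :: "('a, 'd::euclidean_space) pointed_atlas \<Rightarrow>
    ('m, 'e::euclidean_space) pointed_atlas \<Rightarrow> ('m \<Rightarrow> 'e \<Rightarrow> 'e \<Rightarrow> 'e) \<Rightarrow>
    ('a \<Rightarrow> 'm) \<Rightarrow> ('a \<Rightarrow> 'e) \<Rightarrow> 'a \<Rightarrow> 'd \<Rightarrow> 'e" where
  "covd_along cP c \<Gamma> F V p u =
     frechet_derivative (field_rep cP c F V p) (at (cmap cP p p)) u
     + \<Gamma> (F p) (mdiff cP c F p u) (V p)"

definition covd :: "('m, 'e::euclidean_space) pointed_atlas \<Rightarrow>
    ('m \<Rightarrow> 'e \<Rightarrow> 'e \<Rightarrow> 'e) \<Rightarrow> ('m \<Rightarrow> 'e) \<Rightarrow> 'm \<Rightarrow> 'e \<Rightarrow> 'e" where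
  "covd c \<Gamma> Y p u = covd_along c c \<Gamma> (\<lambda>q. q) Y p u"

definition lie_bracket :: "('m, 'e::euclidean_space) pointed_atlas \<Rightarrow>
    ('m \<Rightarrow> 'e) \<Rightarrow> ('m \<Rightarrow> 'e) \<Rightarrow> 'm \<Rightarrow> 'e" where
  "lie_bracket c X Y p =
     frechet_derivative (field_rep c c (\<lambda>q. q) Y p) (at (cmap c p p)) (X p)
     - frechet_derivative (field_rep c c (\<lambda>q. q) X p) (at (cmap c p p)) (Y p)"

text \<open>Torsion-free and metric. The vector fields need only be smooth near the point under
  consideration.\<close>

definition is_levi_civita :: "('m, 'e::euclidean_space) pointed_atlas \<Rightarrow>
    ('m \<Rightarrow> 'e \<Rightarrow> 'e \<Rightarrow> real) \<Rightarrow> ('m \<Rightarrow> 'e \<Rightarrow> 'e \<Rightarrow> 'e) \<Rightarrow> bool" where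
  "is_levi_civita c g \<Gamma> \<longleftrightarrow>
     (\<forall>p. bilinear (\<Gamma> p)) \<and>
     (\<forall>p X Y. smooth_field_at c X p \<and> smooth_field_at c Y p \<longrightarrow>
        covd c \<Gamma> Y p (X p) - covd c \<Gamma> X p (Y p) = lie_bracket c X Y p) \<and>
     (\<forall>p u Y Z. smooth_field_at c Y p \<and> smooth_field_at c Z p \<longrightarrow>
        frechet_derivative ((\<lambda>q. g q (Y q) (Z q)) \<circ> cinv c p) (at (cmap c p p)) u
        = g p (covd c \<Gamma> Y p u) (Z p) + g p (Y p) (covd c \<Gamma> Z p u))"

definition levi_civita :: "('m, 'e::euclidean_space) pointed_atlas \<Rightarrow>
    ('m \<Rightarrow> 'e \<Rightarrow> 'e \<Rightarrow> real) \<Rightarrow> ('m \<Rightarrow> 'e \<Rightarrow> 'e \<Rightarrow> 'e)" where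
  "levi_civita c g = (THE \<Gamma>. is_levi_civita c g \<Gamma>)"


subsection \<open>Kenmotsu manifolds\<close>

definition almost_contact_metric_structure ::
    "('m::topological_space, 'e::euclidean_space) pointed_atlas \<Rightarrow> ('m \<Rightarrow> 'e \<Rightarrow> 'e) \<Rightarrow>
     ('m \<Rightarrow> 'e) \<Rightarrow> ('m \<Rightarrow> 'e \<Rightarrow> real) \<Rightarrow> ('m \<Rightarrow> 'e \<Rightarrow> 'e \<Rightarrow> real) \<Rightarrow> bool" where
  "almost_contact_metric_structure c \<phi> \<xi> \<eta> g \<longleftrightarrow>
     smooth_atlas c \<and> (\<exists>n. DIM('e) = 2 * n + 1) \<and>
     smooth_endomorphism_field c \<phi> \<and> smooth_vector_field c \<xi> \<and> smooth_one_form c \<eta> \<and>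
     riemannian_metric c g \<and>
     (\<forall>p. \<eta> p (\<xi> p) = 1 \<and> \<phi> p (\<xi> p) = 0 \<and>
        (\<forall>X. \<phi> p (\<phi> p X) = - X + \<eta> p X *\<^sub>R \<xi> p \<and> \<eta> p (\<phi> p X) = 0 \<and> g p X (\<xi> p) = \<eta> p X) \<and>
        (\<forall>X Y. g p X Y = g p (\<phi> p X) (\<phi> p Y) + \<eta> p X * \<eta> p Y \<and>
               g p X (\<phi> p Y) = - g p (\<phi> p X) Y))"

definition kenmotsu_manifold ::
    "('m::topological_space, 'e::euclidean_space) pointed_atlas \<Rightarrow> ('m \<Rightarrow> 'e \<Rightarrow> 'e) \<Rightarrow>
     ('m \<Rightarrow> 'e) \<Rightarrow> ('m \<Rightarrow> 'e \<Rightarrow> real) \<Rightarrow> ('m \<Rightarrow> 'e \<Rightarrow> 'e \<Rightarrow> real) \<Rightarrow> bool" where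
  "kenmotsu_manifold c \<phi> \<xi> \<eta> g \<longleftrightarrow>
     almost_contact_metric_structure c \<phi> \<xi> \<eta> g \<and>
     (\<forall>p X Y. smooth_field_at c Y p \<longrightarrow>
        covd c (levi_civita c g) (\<lambda>q. \<phi> q (Y q)) p X - \<phi> p (covd c (levi_civita c g) Y p X)
        = g p (\<phi> p X) (Y p) *\<^sub>R \<xi> p - \<eta> p (Y p) *\<^sub>R \<phi> p X)"


subsection \<open>Submanifolds\<close>

text \<open>
  A submanifold of \<open>(M,c)\<close> is an injectively immersed manifold \<open>F : (P,cP) \<rightarrow> (M,c)\<close>.
  \<open>tspace\<close> and \<open>nspace\<close> are its tangent and normal space inside the tangent space of the ambient
  manifold at \<open>F p\<close>.
\<close>

definition submanifold :: "('a::topological_space, 'd::euclidean_space) pointed_atlas \<Rightarrow>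
    ('m::topological_space, 'e::euclidean_space) pointed_atlas \<Rightarrow> ('a \<Rightarrow> 'm) \<Rightarrow> bool" where
  "submanifold cP c F \<longleftrightarrow>
     smooth_atlas cP \<and> smooth_map cP c F \<and> inj F \<and> (\<forall>p. inj (mdiff cP c F p))"

definition tspace :: "('a, 'd::euclidean_space) pointed_atlas \<Rightarrow>
    ('m, 'e::euclidean_space) pointed_atlas \<Rightarrow> ('a \<Rightarrow> 'm) \<Rightarrow> 'a \<Rightarrow> 'e set" where
  "tspace cP c F p = range (mdiff cP c F p)"

definition nspace :: "('a, 'd::euclidean_space) pointed_atlas \<Rightarrow>
    ('m, 'e::euclidean_space) pointed_atlas \<Rightarrow> ('m \<Rightarrow> 'e \<Rightarrow> 'e \<Rightarrow> real) \<Rightarrow>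
    ('a \<Rightarrow> 'm) \<Rightarrow> 'a \<Rightarrow> 'e set" where
  "nspace cP c g F p = {v. \<forall>w\<in>tspace cP c F p. g (F p) v w = 0}"

definition induced_metric :: "('a, 'd::euclidean_space) pointed_atlas \<Rightarrow>
    ('m, 'e::euclidean_space) pointed_atlas \<Rightarrow> ('m \<Rightarrow> 'e \<Rightarrow> 'e \<Rightarrow> real) \<Rightarrow>
    ('a \<Rightarrow> 'm) \<Rightarrow> 'a \<Rightarrow> 'd \<Rightarrow> 'd \<Rightarrow> real" where
  "induced_metric cP c g F p u v = g (F p) (mdiff cP c F p u) (mdiff cP c F p v)"

definition orth_proj :: "('e::euclidean_space \<Rightarrow> 'e \<Rightarrow> real) \<Rightarrow> 'e set \<Rightarrow> 'e \<Rightarrow> 'e" where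
  "orth_proj b W v = (THE w. w \<in> W \<and> (\<forall>z\<in>W. b (v - w) z = 0))"

text \<open>The angle, in \<open>[0, pi/2]\<close>, between a nonzero vector and its orthogonal projection to a subspace.\<close>

definition angle_with_subspace ::
    "('e::euclidean_space \<Rightarrow> 'e \<Rightarrow> real) \<Rightarrow> 'e \<Rightarrow> 'e set \<Rightarrow> real" where
  "angle_with_subspace b v W =
     (let w = orth_proj b W v in arccos (sqrt (b w w) / sqrt (b v v)))"

definition normal_part :: "('a, 'd::euclidean_space) pointed_atlas \<Rightarrow>
    ('m, 'e::euclidean_space) pointed_atlas \<Rightarrow> ('m \<Rightarrow> 'e \<Rightarrow> 'e \<Rightarrow> real) \<Rightarrow>
    ('a \<Rightarrow> 'm) \<Rightarrow> 'a \<Rightarrow> 'e \<Rightarrow> 'e" where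
  "normal_part cP c g F p v = v - orth_proj (g (F p)) (tspace cP c F p) v"

text \<open>The normal component \<open>N X\<close> of \<open>\<phi> X\<close>; here \<open>X\<close> is a vector of the abstract tangent
  space of the submanifold.\<close>

definition N_op :: "('a, 'd::euclidean_space) pointed_atlas \<Rightarrow>
    ('m, 'e::euclidean_space) pointed_atlas \<Rightarrow> ('m \<Rightarrow> 'e \<Rightarrow> 'e) \<Rightarrow>
    ('m \<Rightarrow> 'e \<Rightarrow> 'e \<Rightarrow> real) \<Rightarrow> ('a \<Rightarrow> 'm) \<Rightarrow> 'a \<Rightarrow> 'd \<Rightarrow> 'e" where
  "N_op cP c \<phi> g F p X = normal_part cP c g F p (\<phi> (F p) (mdiff cP c F p X))"

definition normal_connection :: "('a, 'd::euclidean_space) pointed_atlas \<Rightarrow>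
    ('m, 'e::euclidean_space) pointed_atlas \<Rightarrow> ('m \<Rightarrow> 'e \<Rightarrow> 'e \<Rightarrow> real) \<Rightarrow>
    ('a \<Rightarrow> 'm) \<Rightarrow> ('a \<Rightarrow> 'e) \<Rightarrow> 'a \<Rightarrow> 'd \<Rightarrow> 'e" where
  "normal_connection cP c g F V p X =
     normal_part cP c g F p (covd_along cP c (levi_civita c g) F V p X)"

definition covd_N :: "('a, 'd::euclidean_space) pointed_atlas \<Rightarrow>
    ('m, 'e::euclidean_space) pointed_atlas \<Rightarrow> ('m \<Rightarrow> 'e \<Rightarrow> 'e) \<Rightarrow>
    ('m \<Rightarrow> 'e \<Rightarrow> 'e \<Rightarrow> real) \<Rightarrow> ('a \<Rightarrow> 'm) \<Rightarrow> ('a \<Rightarrow> 'd) \<Rightarrow> ('a \<Rightarrow> 'd) \<Rightarrow> 'a \<Rightarrow> 'e" where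
  "covd_N cP c \<phi> g F X Y p =
     normal_connection cP c g F (\<lambda>q. N_op cP c \<phi> g F q (Y q)) p (X p)
     - N_op cP c \<phi> g F p (covd cP (levi_civita cP (induced_metric cP c g F)) Y p (X p))"

definition invariant_submanifold ::
    "('a::topological_space, 'd::euclidean_space) pointed_atlas \<Rightarrow>
     ('m::topological_space, 'e::euclidean_space) pointed_atlas \<Rightarrow> ('m \<Rightarrow> 'e \<Rightarrow> 'e) \<Rightarrow>
     ('a \<Rightarrow> 'm) \<Rightarrow> bool" where
  "invariant_submanifold cP c \<phi> F \<longleftrightarrow> submanifold cP c F \<and>
     (\<forall>p. \<phi> (F p) ` tspace cP c F p \<subseteq> tspace cP c F p)"

definition slant_submanifold ::
    "('a::topological_space, 'd::euclidean_space) pointed_atlas \<Rightarrow>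
     ('m::topological_space, 'e::euclidean_space) pointed_atlas \<Rightarrow> ('m \<Rightarrow> 'e \<Rightarrow> 'e) \<Rightarrow>
     ('m \<Rightarrow> 'e) \<Rightarrow> ('m \<Rightarrow> 'e \<Rightarrow> 'e \<Rightarrow> real) \<Rightarrow> ('a \<Rightarrow> 'm) \<Rightarrow> real \<Rightarrow> bool" where
  "slant_submanifold cP c \<phi> \<xi> g F \<theta> \<longleftrightarrow> submanifold cP c F \<and>
     (\<forall>p. \<forall>X\<in>tspace cP c F p. X \<noteq> 0 \<and> X \<notin> span {\<xi> (F p)} \<longrightarrow>
        angle_with_subspace (g (F p)) (\<phi> (F p) X) (tspace cP c F p) = \<theta>)"

definition proper_slant_submanifold ::
    "('a::topological_space, 'd::euclidean_space) pointed_atlas \<Rightarrow>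
     ('m::topological_space, 'e::euclidean_space) pointed_atlas \<Rightarrow> ('m \<Rightarrow> 'e \<Rightarrow> 'e) \<Rightarrow>
     ('m \<Rightarrow> 'e) \<Rightarrow> ('m \<Rightarrow> 'e \<Rightarrow> 'e \<Rightarrow> real) \<Rightarrow> ('a \<Rightarrow> 'm) \<Rightarrow> real \<Rightarrow> bool" where
  "proper_slant_submanifold cP c \<phi> \<xi> g F \<theta> \<longleftrightarrow>
     slant_submanifold cP c \<phi> \<xi> g F \<theta> \<and> \<theta> \<noteq> 0 \<and> \<theta> \<noteq> pi / 2"

text \<open>\<open>D1\<close> and \<open>D2\<close> assign to \<open>p\<close> subspaces of the tangent space, regarded inside the ambient
  tangent space at \<open>F p\<close>.\<close>

definition semi_slant_submanifold ::
    "('a::topological_space, 'd::euclidean_space) pointed_atlas \<Rightarrow>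
     ('m::topological_space, 'e::euclidean_space) pointed_atlas \<Rightarrow> ('m \<Rightarrow> 'e \<Rightarrow> 'e) \<Rightarrow>
     ('m \<Rightarrow> 'e) \<Rightarrow> ('m \<Rightarrow> 'e \<Rightarrow> 'e \<Rightarrow> real) \<Rightarrow> ('a \<Rightarrow> 'm) \<Rightarrow>
     ('a \<Rightarrow> 'e set) \<Rightarrow> ('a \<Rightarrow> 'e set) \<Rightarrow> real \<Rightarrow> bool" where
  "semi_slant_submanifold cP c \<phi> \<xi> g F D1 D2 \<theta> \<longleftrightarrow> submanifold cP c F \<and> \<theta> \<noteq> 0 \<and>
     (\<forall>p. subspace (D1 p) \<and> subspace (D2 p) \<and>
        tspace cP c F p = {a + b + r *\<^sub>R \<xi> (F p) | a b r. a \<in> D1 p \<and> b \<in> D2 p} \<and>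
        (\<forall>a\<in>D1 p. \<forall>b\<in>D2 p. g (F p) a b = 0) \<and>
        (\<forall>a\<in>D1 p \<union> D2 p. g (F p) a (\<xi> (F p)) = 0) \<and>
        \<phi> (F p) ` D1 p = D1 p \<and>
        (\<forall>X\<in>D2 p. X \<noteq> 0 \<longrightarrow> angle_with_subspace (g (F p)) (\<phi> (F p) X) (D2 p) = \<theta>))"

text \<open>The orthogonal complement, in the normal space, of \<open>N D\<close>, where \<open>D p\<close> is a set of vectors
  of the abstract tangent space of the submanifold.\<close>

definition normal_complement_N :: "('a, 'd::euclidean_space) pointed_atlas \<Rightarrow>
    ('m, 'e::euclidean_space) pointed_atlas \<Rightarrow> ('m \<Rightarrow> 'e \<Rightarrow> 'e) \<Rightarrow>
    ('m \<Rightarrow> 'e \<Rightarrow> 'e \<Rightarrow> real) \<Rightarrow> ('a \<Rightarrow> 'm) \<Rightarrow> ('a \<Rightarrow> 'd set) \<Rightarrow> 'a \<Rightarrow> 'e set" where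
  "normal_complement_N cP c \<phi> g F D p =
     {v \<in> nspace cP c g F p. \<forall>w \<in> N_op cP c \<phi> g F p ` D p. g (F p) v w = 0}"


subsection \<open>Warped products\<close>

definition warped_metric :: "('a \<Rightarrow> 'ea \<Rightarrow> 'ea \<Rightarrow> real) \<Rightarrow> ('a \<Rightarrow> real) \<Rightarrow>
    ('b \<Rightarrow> 'eb \<Rightarrow> 'eb \<Rightarrow> real) \<Rightarrow> 'a \<times> 'b \<Rightarrow> 'ea \<times> 'eb \<Rightarrow> 'ea \<times> 'eb \<Rightarrow> real" where
  "warped_metric g1 f g2 x u v =
     g1 (fst x) (fst u) (fst v) + (f (fst x))\<^sup>2 * g2 (snd x) (snd u) (snd v)"

definition warped_product_submanifold ::
    "('a::topological_space, 'ea::euclidean_space) pointed_atlas \<Rightarrow> ('a \<Rightarrow> 'ea \<Rightarrow> 'ea \<Rightarrow> real) \<Rightarrow>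
     ('b::topological_space, 'eb::euclidean_space) pointed_atlas \<Rightarrow> ('b \<Rightarrow> 'eb \<Rightarrow> 'eb \<Rightarrow> real) \<Rightarrow>
     ('a \<Rightarrow> real) \<Rightarrow>
     ('m::topological_space, 'e::euclidean_space) pointed_atlas \<Rightarrow> ('m \<Rightarrow> 'e \<Rightarrow> 'e \<Rightarrow> real) \<Rightarrow>
     ('a \<times> 'b \<Rightarrow> 'm) \<Rightarrow> bool" where
  "warped_product_submanifold c1 g1 c2 g2 f c g F \<longleftrightarrow>
     smooth_atlas c1 \<and> riemannian_metric c1 g1 \<and> smooth_atlas c2 \<and> riemannian_metric c2 g2 \<and>
     smooth_fun c1 f \<and> (\<forall>p. f p > 0) \<and> submanifold (prod_atlas c1 c2) c F \<and>
     induced_metric (prod_atlas c1 c2) c g F = warped_metric g1 f g2"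

text \<open>The tangent bundles of the two factors, as subbundles of the tangent bundle of the product.\<close>

definition T_fst :: "'a \<times> 'b \<Rightarrow> ('ea::zero \<times> 'eb::zero) set" where
  "T_fst x = UNIV \<times> {0}"

definition T_snd :: "'a \<times> 'b \<Rightarrow> ('ea::zero \<times> 'eb::zero) set" where
  "T_snd x = {0} \<times> UNIV"

end

theory Submission
  imports Defs
begin

text \<open>
  All derivatives are taken in the chart around one point, where \<open>\<nabla>\<close> becomes the derivative of
  components plus a bilinear Christoffel term. Let \<open>h\<close> be the second fundamental form, \<open>X\<close> tangent
  to \<open>N_T\<close> and \<open>Z\<close>, \<open>W\<close> tangent to \<open>N_\<theta>\<close>, and write \<open>l(X) = X(ln f)\<close>. Koszul's formula for the warped
  metric gives \<open>\<nabla>_X Z = l(X) Z\<close>, and the Kenmotsu identity gives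
  \<open>(\<nabla>_X N) Z = nor (\<phi> h(X,Z)) - h(X, T Z)\<close> and
  \<open>g(h(X,Z), N W) = - l(\<phi> X) g(Z,W) + (l(X) - \<eta>(X)) g(T Z,W)\<close>, so that
  \<open>g((\<nabla>_X N) Z, N W) = 2 l(\<phi> X) g(T Z,W) + 2 (l(X) - \<eta>(X)) g(T Z, T W)\<close>.
  In the direction of \<open>X\<close> the metric on \<open>T N_\<theta>\<close> grows at the rate \<open>2 l(X)\<close> and the fundamental
  2-form \<open>g(\<phi> Z, W)\<close> at the rate \<open>2 \<eta>(X)\<close>. As \<open>|T Z| = cos \<theta> |Z|\<close> with \<open>cos \<theta> \<noteq> 0\<close> constant, the two
  rates agree: \<open>l = \<eta>\<close>, hence \<open>l(\<phi> X) = \<eta>(\<phi> X) = 0\<close>, and the inner product vanishes.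
\<close>

text \<open>The decisive step is the equality of the two rates. On the second factor
  \<open>T\<close> is fixed by the condition that g(T z, w) equals the 2-form g(\<phi> z, w). If the
  metric grows at rate 2 l(X) and the 2-form at rate 2 \<eta>(X), then \<open>T\<close> is dilated
  at rate 2 (\<eta>(X) - l(X)), which a constant ratio |T Z| / |Z| > 0 forbids unless l = \<eta>.
  Arguing this way would mean differentiating the field T Z. Instead w = T z is frozen at one point,
  and z, w are extended by constant components. With C the squared cosine, Cauchy-Schwarz makes C
  |z|^2 |w|^2 - g(\<phi> z, w)^2 nonnegative nearby; it is zero at the point, so its derivative
  vanishes there. The obstacle elsewhere is the encoding. Components at p refer to the chart
  \<open>c p\<close>, and neighbouring points may carry unrelated charts, so the raw values of a
  smooth field need not even be continuous. Connections are definite descriptions and tangential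
  parts are chosen pointwise, so existence, uniqueness and differentiability must be secured before
  the geometric identities can be used.\<close>

section \<open>Calculus of families of linear maps and of linear systems\<close>

lemma has_derivative_linear_family_apply:
  fixes A :: "'x::real_normed_vector \<Rightarrow> 'v::euclidean_space \<Rightarrow> 'w::real_normed_vector"
  assumes lin: "\<forall>\<^sub>F x in nhds x0. linear (A x)"
    and A': "\<And>v. ((\<lambda>x. A x v) has_derivative A' v) (at x0)"
    and V: "(V has_derivative V') (at x0)"
  shows "((\<lambda>x. A x (V x)) has_derivative (\<lambda>h. A' (V x0) h + A x0 (V' h))) (at x0)"
proof -
  \<comment> \<open>In the basis the family becomes finitely many functions \<open>A x i\<close>
    with scalar coefficients, so differentiability for each fixed vector suffices.\<close>
  have expand: "A x w = (\<Sum>i\<in>Basis. (w \<bullet> i) *\<^sub>R A x i)" if "linear (A x)" for x w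
  proof -
    have "A x w = A x (\<Sum>i\<in>Basis. (w \<bullet> i) *\<^sub>R i)"
      by (simp add: euclidean_representation)
    also have "\<dots> = (\<Sum>i\<in>Basis. (w \<bullet> i) *\<^sub>R A x i)"
      using that by (simp add: linear_sum linear_cmul)
    finally show ?thesis .
  qed
  obtain N where N: "open N" "x0 \<in> N" "\<And>x. x \<in> N \<Longrightarrow> linear (A x)"
    using lin by (auto simp: eventually_nhds)
  have deriv: "((\<lambda>x. \<Sum>i\<in>Basis. (W x \<bullet> i) *\<^sub>R A x i) has_derivative
      (\<lambda>h. \<Sum>i\<in>Basis. (W x0 \<bullet> i) *\<^sub>R A' i h + (W' h \<bullet> i) *\<^sub>R A x0 i)) (at x0)"
    if "(W has_derivative W') (at x0)" for W W'
    by (intro has_derivative_sum has_derivative_scaleR A' has_derivative_inner_left that)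
  have "((\<lambda>x. A x (V x0)) has_derivative
      (\<lambda>h. \<Sum>i\<in>Basis. (V x0 \<bullet> i) *\<^sub>R A' i h + (0 \<bullet> i) *\<^sub>R A x0 i)) (at x0)"
    using deriv[OF has_derivative_const[of "V x0"]] N(1,2)
    by (rule has_derivative_transform_within_open) (rule expand[OF N(3), symmetric])
  \<comment> \<open>Linearity of \<open>A'\<close> in its vector argument is not assumed;
    differentiating along the constant \<open>V x0\<close> supplies it.\<close>
  then have A'V: "A' (V x0) = (\<lambda>h. \<Sum>i\<in>Basis. (V x0 \<bullet> i) *\<^sub>R A' i h)"
    using has_derivative_unique[OF A'] by simp
  have "((\<lambda>x. A x (V x)) has_derivative
      (\<lambda>h. \<Sum>i\<in>Basis. (V x0 \<bullet> i) *\<^sub>R A' i h + (V' h \<bullet> i) *\<^sub>R A x0 i)) (at x0)"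
    using deriv[OF V] N(1,2)
    by (rule has_derivative_transform_within_open) (rule expand[OF N(3), symmetric])
  then show ?thesis
    by (simp add: A'V expand[OF N(3)[OF N(2)], symmetric] sum.distrib)
qed

lemma has_derivative_bilinear_family_apply:
  fixes B :: "'x::real_normed_vector \<Rightarrow> 'u::euclidean_space \<Rightarrow> 'v::euclidean_space \<Rightarrow> 'w::real_normed_vector"
  assumes bil: "\<forall>\<^sub>F x in nhds x0. bilinear (B x)"
    and B': "\<And>u v. ((\<lambda>x. B x u v) has_derivative B' u v) (at x0)"
    and U: "(U has_derivative U') (at x0)" and V: "(V has_derivative V') (at x0)"
  shows "((\<lambda>x. B x (U x) (V x)) has_derivative
    (\<lambda>h. B' (U x0) (V x0) h + B x0 (U' h) (V x0) + B x0 (U x0) (V' h))) (at x0)"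
proof -
  have 1: "\<forall>\<^sub>F x in nhds x0. linear (\<lambda>u. B x u v)" for v
    using bil by eventually_elim (simp add: bilinear_def)
  have 2: "((\<lambda>x. B x (U x) v) has_derivative (\<lambda>h. B' (U x0) v h + B x0 (U' h) v)) (at x0)" for v
    by (rule has_derivative_linear_family_apply[OF 1 B' U])
  have 3: "\<forall>\<^sub>F x in nhds x0. linear (B x (U x))"
    using bil by eventually_elim (simp add: bilinear_def)
  show ?thesis
    by (rule has_derivative_linear_family_apply[OF 3 2 V])
qed

text \<open>The zero of \<open>k\<close> makes up for the missing derivative of \<open>s\<close>:
  the error (s x - s x0) k x is a factor tending to 0 times a term of order |x - x0|. It lifts
  continuity to differentiability in the next lemma.\<close>

lemma has_derivative_scaleR_vanishing:
  fixes s :: "'x::real_normed_vector \<Rightarrow> real" and k :: "'x \<Rightarrow> 'w::real_normed_vector"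
  assumes s: "isCont s x0" and k: "(k has_derivative k') (at x0)" and "k x0 = 0"
  shows "((\<lambda>x. s x *\<^sub>R k x) has_derivative (\<lambda>h. s x0 *\<^sub>R k' h)) (at x0)"
proof -
  have k'_lin: "bounded_linear k'" using k by (rule has_derivative_bounded_linear)
  then obtain K where K: "K > 0" "\<And>h. norm (k' h) \<le> norm h * K"
    using bounded_linear.pos_bounded by blast
  have "((\<lambda>x. (s x - s x0) *\<^sub>R k x) has_derivative (\<lambda>h. 0)) (at x0)"
    unfolding has_derivative_at_alt
  proof (intro conjI allI impI)
    fix e :: real assume e: "e > 0"
    \<comment> \<open>1 + K bounds |k y| / |y - x0| near \<open>x0\<close>: K from the derivative, 1
      from the remainder at tolerance 1.\<close>
    have "e / (1 + K) > 0" using e K by simp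
    then obtain d1 where d1: "d1 > 0" "\<And>y. dist y x0 < d1 \<Longrightarrow> dist (s y) (s x0) < e / (1 + K)"
      using s unfolding continuous_at_eps_delta by metis
    obtain d2 where d2: "d2 > 0"
      "\<And>y. norm (y - x0) < d2 \<Longrightarrow> norm (k y - k' (y - x0)) \<le> 1 * norm (y - x0)"
      using k \<open>k x0 = 0\<close> unfolding has_derivative_at_alt by (metis diff_zero zero_less_one)
    show "\<exists>d>0. \<forall>y. norm (y - x0) < d \<longrightarrow>
      norm ((s y - s x0) *\<^sub>R k y - (s x0 - s x0) *\<^sub>R k x0 - 0) \<le> e * norm (y - x0)"
    proof (intro exI[of _ "min d1 d2"] conjI allI impI)
      fix y assume y: "norm (y - x0) < min d1 d2"
      have "norm (k y) \<le> norm (k y - k' (y - x0)) + norm (k' (y - x0))"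
        by (metis norm_triangle_sub add.commute)
      also have "\<dots> \<le> (1 + K) * norm (y - x0)"
        using d2(2)[of y] K(2)[of "y - x0"] y by (simp add: algebra_simps)
      finally have ky: "norm (k y) \<le> (1 + K) * norm (y - x0)" .
      have "norm ((s y - s x0) *\<^sub>R k y) = \<bar>s y - s x0\<bar> * norm (k y)" by simp
      also have "\<dots> \<le> e / (1 + K) * ((1 + K) * norm (y - x0))"
        using d1(2)[of y] y ky e K by (intro mult_mono) (auto simp: dist_norm)
      also have "\<dots> = e * norm (y - x0)" using K by simp
      finally show "norm ((s y - s x0) *\<^sub>R k y - (s x0 - s x0) *\<^sub>R k x0 - 0) \<le> e * norm (y - x0)"
        by simp
    qed (use d1 d2 in auto)
  qed simp
  moreover have "((\<lambda>x. s x0 *\<^sub>R k x) has_derivative (\<lambda>h. s x0 *\<^sub>R k' h)) (at x0)"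
    by (intro has_derivative_scaleR_right k)
  ultimately have "((\<lambda>x. (s x - s x0) *\<^sub>R k x + s x0 *\<^sub>R k x) has_derivative
      (\<lambda>h. 0 + s x0 *\<^sub>R k' h)) (at x0)"
    by (rule has_derivative_add)
  then show ?thesis by (simp flip: scaleR_left_distrib)
qed

text \<open>Nothing is known about the regularity of \<open>t\<close>. A left inverse of
  \<open>A x0\<close> turns the system into a fixed point equation t = L b - C t with C zero at
  \<open>x0\<close>; this gives first boundedness, then continuity, then differentiability. It
  serves for tangential parts, which are picked pointwise.\<close>

lemma differentiable_linear_solution:
  fixes A :: "'x::real_normed_vector \<Rightarrow> 'v::euclidean_space \<Rightarrow> 'v"
  assumes lin: "\<forall>\<^sub>F x in nhds x0. linear (A x)"
    and A': "\<And>v. (\<lambda>x. A x v) differentiable (at x0)"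
    and inj: "inj (A x0)"
    and b: "b differentiable (at x0)"
    and sol: "\<forall>\<^sub>F x in nhds x0. A x (t x) = b x"
  shows "t differentiable (at x0)"
proof -
  have lin0: "linear (A x0)" using lin by (rule eventually_nhds_x_imp_x)
  obtain L where L: "linear L" "\<And>v. L (A x0 v) = v"
    using linear_injective_left_inverse[OF lin0 inj] by (auto simp: fun_eq_iff)
  have bl: "bounded_linear L" using L(1) by (simp add: linear_conv_bounded_linear)
  define C where "C = (\<lambda>x v. L (A x v - A x0 v))"
  have C0: "C x0 v = 0" for v by (simp add: C_def linear_0[OF L(1)])
  have C_diff: "(\<lambda>x. C x v) differentiable (at x0)" for v
    unfolding C_def
    by (rule differentiable_compose[of L, unfolded o_def])
       (use A' L in \<open>auto intro!: linear_imp_differentiable differentiable_diff\<close>)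
  have Lb_diff: "(\<lambda>x. L (b x)) differentiable (at x0)"
    by (rule differentiable_compose[of L, unfolded o_def])
       (use b L in \<open>auto intro!: linear_imp_differentiable\<close>)
  have C_expand: "\<forall>\<^sub>F x in nhds x0. \<forall>v. C x v = (\<Sum>i\<in>Basis. (v \<bullet> i) *\<^sub>R C x i)"
    using lin
  proof eventually_elim
    fix x assume "linear (A x)"
    then have C: "linear (C x)"
      unfolding C_def using linear_compose[OF linear_compose_sub[OF _ lin0] L(1)] by (simp add: o_def)
    show "\<forall>v. C x v = (\<Sum>i\<in>Basis. (v \<bullet> i) *\<^sub>R C x i)"
    proof
      fix v
      have "C x v = C x (\<Sum>i\<in>Basis. (v \<bullet> i) *\<^sub>R i)"
        by (simp add: euclidean_representation)
      also have "\<dots> = (\<Sum>i\<in>Basis. (v \<bullet> i) *\<^sub>R C x i)"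
        using C by (simp add: linear_sum linear_cmul)
      finally show "C x v = (\<Sum>i\<in>Basis. (v \<bullet> i) *\<^sub>R C x i)" .
    qed
  qed
  have t_eq: "\<forall>\<^sub>F x in nhds x0. t x = L (b x) - C x (t x)"
    using sol by eventually_elim (simp add: C_def linear_diff[OF L(1)] L(2))
  define eps where "eps = (\<lambda>x. \<Sum>i\<in>Basis. norm (C x i))"
  have C_le: "\<forall>\<^sub>F x in nhds x0. norm (C x (t x)) \<le> norm (t x) * eps x"
    using C_expand
  proof eventually_elim
    fix x assume "\<forall>v. C x v = (\<Sum>i\<in>Basis. (v \<bullet> i) *\<^sub>R C x i)"
    then have "norm (C x (t x)) \<le> (\<Sum>i\<in>Basis. norm ((t x \<bullet> i) *\<^sub>R C x i))"
      by (metis norm_sum)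
    also have "\<dots> \<le> (\<Sum>i\<in>Basis. norm (t x) * norm (C x i))"
      by (intro sum_mono) (auto intro!: mult_right_mono Basis_le_norm)
    finally show "norm (C x (t x)) \<le> norm (t x) * eps x"
      by (simp add: eps_def sum_distrib_left)
  qed
  have C_cont: "isCont (\<lambda>x. C x v) x0" for v
    using C_diff by (rule differentiable_imp_continuous_within)
  have eps_tendsto: "(eps \<longlongrightarrow> 0) (at x0)"
  proof -
    have "isCont eps x0" unfolding eps_def by (intro continuous_intros C_cont)
    then show ?thesis by (simp add: isCont_def eps_def C0)
  qed
  have Lb_tendsto: "((\<lambda>x. L (b x)) \<longlongrightarrow> L (b x0)) (at x0)"
    using differentiable_imp_continuous_within[OF Lb_diff] by (simp add: continuous_within)
  have at_le: "at x0 \<le> nhds x0" by (simp add: at_within_def)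
  \<comment> \<open>Below 1/2, the term C t can be absorbed into the left side of the norm estimate
    for t.\<close>
  have eps_small: "\<forall>\<^sub>F x in at x0. eps x < 1/2"
    using order_tendstoD(2)[OF eps_tendsto, of "1/2"] by simp
  have Lb_small: "\<forall>\<^sub>F x in at x0. norm (L (b x)) < norm (L (b x0)) + 1"
    using order_tendstoD(2)[OF tendsto_norm[OF Lb_tendsto], of "norm (L (b x0)) + 1"] by simp
  have bound: "\<forall>\<^sub>F x in at x0. norm (t x) \<le> 2 * (norm (L (b x0)) + 1)"
    using filter_leD[OF at_le t_eq] filter_leD[OF at_le C_le] eps_small Lb_small
  proof eventually_elim
    fix x assume x: "t x = L (b x) - C x (t x)" "norm (C x (t x)) \<le> norm (t x) * eps x"
      "eps x < 1/2" "norm (L (b x)) < norm (L (b x0)) + 1"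
    have "norm (t x) \<le> norm (L (b x)) + norm (C x (t x))"
      by (metis norm_triangle_ineq4 x(1))
    moreover have "norm (C x (t x)) \<le> norm (t x) / 2"
      using mult_left_mono[of "eps x" "1/2" "norm (t x)"] x(2,3) by simp
    ultimately have "norm (t x) \<le> 2 * norm (L (b x))" by simp
    also have "\<dots> \<le> 2 * (norm (L (b x0)) + 1)" using x(4) by simp
    finally show "norm (t x) \<le> 2 * (norm (L (b x0)) + 1)" .
  qed
  have "((\<lambda>x. 2 * (norm (L (b x0)) + 1) * \<bar>eps x\<bar>) \<longlongrightarrow> 0) (at x0)"
    using tendsto_mult_right_zero[OF tendsto_rabs_zero[OF eps_tendsto]] .
  then have "((\<lambda>x. C x (t x)) \<longlongrightarrow> 0) (at x0)"
  proof (rule Lim_null_comparison[rotated])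
    show "\<forall>\<^sub>F x in at x0. norm (C x (t x)) \<le> 2 * (norm (L (b x0)) + 1) * \<bar>eps x\<bar>"
      using bound filter_leD[OF at_le C_le]
    proof eventually_elim
      fix x assume x: "norm (t x) \<le> 2 * (norm (L (b x0)) + 1)" "norm (C x (t x)) \<le> norm (t x) * eps x"
      have "norm (t x) * eps x \<le> norm (t x) * \<bar>eps x\<bar>" by (intro mult_left_mono) auto
      also have "\<dots> \<le> 2 * (norm (L (b x0)) + 1) * \<bar>eps x\<bar>"
        using x(1) by (intro mult_right_mono) auto
      finally show "norm (C x (t x)) \<le> 2 * (norm (L (b x0)) + 1) * \<bar>eps x\<bar>" using x(2) by linarith
    qed
  qed
  then have "((\<lambda>x. L (b x) - C x (t x)) \<longlongrightarrow> L (b x0) - 0) (at x0)"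
    by (intro tendsto_diff Lb_tendsto)
  moreover have "t x0 = L (b x0) - 0"
    using eventually_nhds_x_imp_x[OF t_eq] by (simp add: C0)
  moreover have "\<forall>\<^sub>F x in at x0. L (b x) - C x (t x) = t x"
    using filter_leD[OF at_le t_eq] by eventually_elim simp
  ultimately have t_cont: "isCont t x0"
    unfolding isCont_def by (simp add: Lim_transform_eventually)
  obtain C' where C': "\<And>v. ((\<lambda>x. C x v) has_derivative C' v) (at x0)"
    using C_diff unfolding differentiable_def by metis
  obtain l where l: "((\<lambda>x. L (b x)) has_derivative l) (at x0)"
    using Lb_diff unfolding differentiable_def by blast
  \<comment> \<open>\<open>t\<close> occurs on the right only as a continuous coefficient of
    functions vanishing at \<open>x0\<close>, so the right side has a derivative.\<close>
  have D: "((\<lambda>x. L (b x) - (\<Sum>i\<in>Basis. (t x \<bullet> i) *\<^sub>R C x i)) has_derivative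
      (\<lambda>h. l h - (\<Sum>i\<in>Basis. (t x0 \<bullet> i) *\<^sub>R C' i h))) (at x0)"
    by (intro has_derivative_diff l has_derivative_sum has_derivative_scaleR_vanishing C' C0)
       (auto intro!: continuous_intros t_cont)
  have ev: "\<forall>\<^sub>F x in nhds x0. t x = L (b x) - (\<Sum>i\<in>Basis. (t x \<bullet> i) *\<^sub>R C x i)"
    using t_eq C_expand by eventually_elim metis
  then obtain N where N: "open N" "x0 \<in> N"
    "\<And>x. x \<in> N \<Longrightarrow> t x = L (b x) - (\<Sum>i\<in>Basis. (t x \<bullet> i) *\<^sub>R C x i)"
    by (auto simp: eventually_nhds)
  show ?thesis
    unfolding differentiable_def
    using has_derivative_transform_within_open[OF D N(1,2)] N(3)[symmetric] by blast
qed

section \<open>Symmetry of second derivatives\<close>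

text \<open>The mean value theorem is used twice: in s for the difference of the rows t = h and t =
  0, then in t for \<open>P1 s\<close>.\<close>

lemma second_difference_mvt:
  fixes P :: "real \<Rightarrow> real \<Rightarrow> real"
  assumes h: "h > 0"
    and P1: "\<And>s t. 0 \<le> s \<Longrightarrow> s \<le> h \<Longrightarrow> 0 \<le> t \<Longrightarrow> t \<le> h \<Longrightarrow> ((\<lambda>s. P s t) has_real_derivative P1 s t) (at s)"
    and P12: "\<And>s t. 0 \<le> s \<Longrightarrow> s \<le> h \<Longrightarrow> 0 \<le> t \<Longrightarrow> t \<le> h \<Longrightarrow> (P1 s has_real_derivative P12 s t) (at t)"
  shows "\<exists>s t. 0 < s \<and> s < h \<and> 0 < t \<and> t < h \<and>
    P h h - P h 0 - P 0 h + P 0 0 = h * h * P12 s t"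
proof -
  have "\<exists>s>0. s < h \<and> (P h h - P h 0) - (P 0 h - P 0 0) = (h - 0) * (P1 s h - P1 s 0)"
    by (rule MVT2[OF h]) (auto intro!: DERIV_diff P1 simp: h less_imp_le)
  then obtain s where s: "0 < s" "s < h"
    "(P h h - P h 0) - (P 0 h - P 0 0) = h * (P1 s h - P1 s 0)" by auto
  have "\<exists>t>0. t < h \<and> P1 s h - P1 s 0 = (h - 0) * P12 s t"
    by (rule MVT2[OF h]) (use s in \<open>auto intro!: P12\<close>)
  then obtain t where t: "0 < t" "t < h" "P1 s h - P1 s 0 = h * P12 s t" by auto
  show ?thesis
    by (rule exI[of _ s], rule exI[of _ t]) (use s t in \<open>simp add: algebra_simps\<close>)
qed

text \<open>The second difference over a small parallelogram spanned by multiples of u and v does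
  not depend on the order of differencing. Each order expresses it by one of the mixed derivatives
  at an intermediate point, and continuity moves both points to \<open>x\<close>.\<close>

lemma frechet_derivative_commute:
  fixes f :: "'a::euclidean_space \<Rightarrow> 'b::euclidean_space"
  assumes C2: "Ck_on 2 f S" and S: "open S" "x \<in> S"
  shows "frechet_derivative (\<lambda>y. frechet_derivative f (at y) u) (at x) v =
         frechet_derivative (\<lambda>y. frechet_derivative f (at y) v) (at x) u"
proof (rule euclidean_eqI)
  fix b :: 'b assume "b \<in> Basis"
  define D1 where "D1 = (\<lambda>w y. frechet_derivative f (at y) w)"
  define D2 where "D2 = (\<lambda>w z y. frechet_derivative (D1 w) (at y) z)"
  have f: "(f has_derivative (\<lambda>w. D1 w y)) (at y)" if "y \<in> S" for y
    using C2 that by (simp add: numeral_2_eq_2 D1_def frechet_derivative_works)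
  have D1: "(D1 w has_derivative (\<lambda>z. D2 w z y)) (at y)" if "y \<in> S" for y w
    using C2 that by (simp add: numeral_2_eq_2 D2_def frechet_derivative_works) (simp add: D1_def)
  have D2: "continuous_on S (D2 w z)" for w z
    using C2 by (simp add: numeral_2_eq_2 D2_def) (simp add: D1_def)
  have line: "((\<lambda>s. k (y + s *\<^sub>R w) \<bullet> b) has_real_derivative k' w \<bullet> b) (at s)"
    if "(k has_derivative k') (at (y + s *\<^sub>R w))" for k :: "'a \<Rightarrow> 'b" and k' y s w
  proof -
    have 1: "((\<lambda>s. y + s *\<^sub>R w) has_derivative (\<lambda>h. h *\<^sub>R w)) (at s)"
      by (auto intro!: derivative_eq_intros)
    have "((\<lambda>s. k (y + s *\<^sub>R w) \<bullet> b) has_derivative (\<lambda>h. k' (h *\<^sub>R w) \<bullet> b)) (at s)"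
      using has_derivative_inner_left[OF has_derivative_compose[OF 1 that]] .
    moreover have "(\<lambda>h. k' (h *\<^sub>R w) \<bullet> b) = (*) (k' w \<bullet> b)"
      using has_derivative_linear[OF that] by (auto simp: linear_cmul)
    ultimately show ?thesis by (simp add: has_field_derivative_def)
  qed
  have *: "\<forall>e>0. \<bar>D2 u v x \<bullet> b - D2 v u x \<bullet> b\<bar> < e"
  proof safe
    fix e :: real assume e: "e > 0"
    have "\<exists>d>0. \<forall>y. dist y x < d \<longrightarrow> y \<in> S \<and> \<bar>D2 w z y \<bullet> b - D2 w z x \<bullet> b\<bar> < e / 2" for w z
    proof -
      have "isCont (\<lambda>y. D2 w z y \<bullet> b) x"
        using D2[of w z] S by (simp add: continuous_on_eq_continuous_at continuous_intros)
      then obtain d1 where "d1 > 0" "\<And>y. dist y x < d1 \<Longrightarrow> dist (D2 w z y \<bullet> b) (D2 w z x \<bullet> b) < e/2"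
        using e unfolding continuous_at_eps_delta by (metis half_gt_zero)
      moreover obtain d2 where "d2 > 0" "\<And>y. dist y x < d2 \<Longrightarrow> y \<in> S"
        using S by (metis open_dist)
      ultimately show ?thesis
        by (intro exI[of _ "min d1 d2"]) (auto simp: dist_real_def)
    qed note near = this
    obtain d1 where d1: "d1 > 0" "\<And>y. dist y x < d1 \<Longrightarrow> y \<in> S \<and> \<bar>D2 u v y \<bullet> b - D2 u v x \<bullet> b\<bar> < e / 2"
      using near by metis
    obtain d2 where d2: "d2 > 0" "\<And>y. dist y x < d2 \<Longrightarrow> y \<in> S \<and> \<bar>D2 v u y \<bullet> b - D2 v u x \<bullet> b\<bar> < e / 2"
      using near by metis
    define d where "d = min d1 d2"
    \<comment> \<open>Chosen so that the whole parallelogram stays within d of \<open>x\<close>; the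
      1 covers u = v = 0.\<close>
    define h where "h = d / (2 * (norm u + norm v + 1))"
    have n: "norm u + norm v + 1 > 0" by (simp add: add_nonneg_pos)
    have d: "d > 0" and h: "h > 0" using d1 d2 n by (auto simp: d_def h_def)
    have close: "dist (x + s *\<^sub>R u + t *\<^sub>R v) x < d" if "0 \<le> s" "s \<le> h" "0 \<le> t" "t \<le> h" for s t
    proof -
      have "dist (x + s *\<^sub>R u + t *\<^sub>R v) x \<le> s * norm u + t * norm v"
        using that norm_triangle_ineq[of "s *\<^sub>R u" "t *\<^sub>R v"] by (simp add: dist_norm add.assoc)
      also have "\<dots> \<le> h * norm u + h * norm v"
        using that by (intro add_mono mult_right_mono) auto
      also have "\<dots> < h * (2 * (norm u + norm v + 1))"
      proof -
        have "0 \<le> h * norm u" "0 \<le> h * norm v" using h by auto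
        then show ?thesis using h by (simp add: algebra_simps add_pos_nonneg add_nonneg_pos)
      qed
      also have "\<dots> = d" using n by (simp add: h_def)
      finally show ?thesis .
    qed
    have inS: "x + s *\<^sub>R u + t *\<^sub>R v \<in> S" if "0 \<le> s" "s \<le> h" "0 \<le> t" "t \<le> h" for s t
      using close[OF that] d1 by (simp add: d_def)
    define P where "P = (\<lambda>s t. f (x + s *\<^sub>R u + t *\<^sub>R v) \<bullet> b)"
    have "\<exists>s t. 0 < s \<and> s < h \<and> 0 < t \<and> t < h \<and>
        P h h - P h 0 - P 0 h + P 0 0 = h * h * (D2 u v (x + s *\<^sub>R u + t *\<^sub>R v) \<bullet> b)"
    proof (rule second_difference_mvt[OF h, where ?P1.0 = "\<lambda>s t. D1 u (x + s *\<^sub>R u + t *\<^sub>R v) \<bullet> b"])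
      fix s t :: real assume st: "0 \<le> s" "s \<le> h" "0 \<le> t" "t \<le> h"
      show "((\<lambda>s. P s t) has_real_derivative D1 u (x + s *\<^sub>R u + t *\<^sub>R v) \<bullet> b) (at s)"
        using line[of f "\<lambda>w. D1 w (x + s *\<^sub>R u + t *\<^sub>R v)" "x + t *\<^sub>R v" s u] f[OF inS[OF st]]
        by (simp add: P_def add_ac)
      show "((\<lambda>t. D1 u (x + s *\<^sub>R u + t *\<^sub>R v) \<bullet> b) has_real_derivative
          D2 u v (x + s *\<^sub>R u + t *\<^sub>R v) \<bullet> b) (at t)"
        using line[of "D1 u" _ "x + s *\<^sub>R u" t v] D1[OF inS[OF st]] by blast
    qed
    then obtain s t where st: "0 < s" "s < h" "0 < t" "t < h"
      "P h h - P h 0 - P 0 h + P 0 0 = h * h * (D2 u v (x + s *\<^sub>R u + t *\<^sub>R v) \<bullet> b)" by blast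
    have "\<exists>t s. 0 < t \<and> t < h \<and> 0 < s \<and> s < h \<and>
        P h h - P 0 h - P h 0 + P 0 0 = h * h * (D2 v u (x + s *\<^sub>R u + t *\<^sub>R v) \<bullet> b)"
    proof (rule second_difference_mvt[OF h, of "\<lambda>t s. P s t" "\<lambda>t s. D1 v (x + s *\<^sub>R u + t *\<^sub>R v) \<bullet> b"])
      fix s t :: real assume st: "0 \<le> t" "t \<le> h" "0 \<le> s" "s \<le> h"
      show "(P s has_real_derivative D1 v (x + s *\<^sub>R u + t *\<^sub>R v) \<bullet> b) (at t)"
        using line[of f "\<lambda>w. D1 w (x + s *\<^sub>R u + t *\<^sub>R v)" "x + s *\<^sub>R u" t v] f[OF inS[OF st(3,4,1,2)]]
        by (simp add: P_def)
      show "((\<lambda>s. D1 v (x + s *\<^sub>R u + t *\<^sub>R v) \<bullet> b) has_real_derivative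
          D2 v u (x + s *\<^sub>R u + t *\<^sub>R v) \<bullet> b) (at s)"
        using line[of "D1 v" "\<lambda>w. D2 v w (x + s *\<^sub>R u + t *\<^sub>R v)" "x + t *\<^sub>R v" s u] D1[OF inS[OF st(3,4,1,2)]]
        by (simp add: add_ac)
    qed
    then obtain s' t' where st': "0 < s'" "s' < h" "0 < t'" "t' < h"
      "P h h - P 0 h - P h 0 + P 0 0 = h * h * (D2 v u (x + s' *\<^sub>R u + t' *\<^sub>R v) \<bullet> b)" by blast
    have "h * h * (D2 u v (x + s *\<^sub>R u + t *\<^sub>R v) \<bullet> b) = h * h * (D2 v u (x + s' *\<^sub>R u + t' *\<^sub>R v) \<bullet> b)"
      using st(5) st'(5) by linarith
    then have eq: "D2 u v (x + s *\<^sub>R u + t *\<^sub>R v) \<bullet> b = D2 v u (x + s' *\<^sub>R u + t' *\<^sub>R v) \<bullet> b"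
      using h by simp
    have "\<bar>D2 u v (x + s *\<^sub>R u + t *\<^sub>R v) \<bullet> b - D2 u v x \<bullet> b\<bar> < e / 2"
      using d1(2) close[of s t] st by (simp add: d_def)
    moreover have "\<bar>D2 v u (x + s' *\<^sub>R u + t' *\<^sub>R v) \<bullet> b - D2 v u x \<bullet> b\<bar> < e / 2"
      using d2(2) close[of s' t'] st' by (simp add: d_def)
    ultimately show "\<bar>D2 u v x \<bullet> b - D2 v u x \<bullet> b\<bar> < e"
      unfolding eq by (metis abs_triangle_half_r)
  qed
  have "D2 u v x \<bullet> b = D2 v u x \<bullet> b"
    using *[rule_format, of "\<bar>D2 u v x \<bullet> b - D2 v u x \<bullet> b\<bar>"] by force
  then show "frechet_derivative (\<lambda>y. frechet_derivative f (at y) u) (at x) v \<bullet> b =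
        frechet_derivative (\<lambda>y. frechet_derivative f (at y) v) (at x) u \<bullet> b"
    by (simp add: D1_def D2_def)
qed

section \<open>Derivatives and smoothness depend only on germs\<close>

lemma has_derivative_cong_nhds:
  assumes "(f has_derivative f') (at x)" "\<forall>\<^sub>F y in nhds x. g y = f y"
  shows "(g has_derivative f') (at x)"
proof -
  obtain S where "open S" "x \<in> S" "\<And>y. y \<in> S \<Longrightarrow> g y = f y"
    using assms(2) by (auto simp: eventually_nhds)
  then show ?thesis using has_derivative_transform_within_open[OF assms(1)] by metis
qed

lemma frechet_derivative_cong_nhds:
  assumes "\<forall>\<^sub>F y in nhds x. g y = f y"
  shows "frechet_derivative g (at x) = frechet_derivative f (at x)"
proof -
  have "(g has_derivative D) (at x) \<longleftrightarrow> (f has_derivative D) (at x)" for D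
    using has_derivative_cong_nhds[of f D x g] has_derivative_cong_nhds[of g D x f] assms
    by (auto simp: eq_commute)
  then show ?thesis by (simp add: frechet_derivative_def)
qed

lemma Ck_on_cong:
  assumes "open S" "\<And>x. x \<in> S \<Longrightarrow> f x = h x" "Ck_on k f S"
  shows "Ck_on k h S"
  using assms(2,3)
proof (induction k arbitrary: f h)
  case 0
  then show ?case by (auto cong: continuous_on_cong)
next
  case (Suc k)
  have ev: "\<forall>\<^sub>F y in nhds x. h y = f y" if "x \<in> S" for x
    using that Suc.prems(1) assms(1) by (auto simp: eventually_nhds)
  have "frechet_derivative f (at x) = frechet_derivative h (at x)" if "x \<in> S" for x
    using frechet_derivative_cong_nhds[OF ev[OF that]] by simp
  then have "Ck_on k (\<lambda>x. frechet_derivative h (at x) v) S" for v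
    using Suc.prems(2)
      Suc.IH[of "\<lambda>x. frechet_derivative f (at x) v" "\<lambda>x. frechet_derivative h (at x) v"] by simp
  moreover have "h differentiable (at x)" if "x \<in> S" for x
    using has_derivative_cong_nhds[OF _ ev[OF that]] Suc.prems(2) that
    unfolding Ck_on.simps differentiable_def by blast
  ultimately show ?case by simp
qed

lemma Ck_on_const: "Ck_on k (\<lambda>x. c) S"
proof (induction k arbitrary: c)
  case (Suc k)
  have "frechet_derivative (\<lambda>x. c) (at x) = (\<lambda>h. 0)" for x :: 'a
    by (rule frechet_derivative_at[symmetric]) (rule has_derivative_const)
  then show ?case by (simp add: Suc)
qed simp

lemma smooth_near_eventually_const:
  assumes "\<forall>\<^sub>F y in nhds x. f y = c"
  shows "smooth_near f x"
proof -
  obtain S where "open S" "x \<in> S" "\<And>y. y \<in> S \<Longrightarrow> f y = c"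
    using assms by (auto simp: eventually_nhds)
  then show ?thesis
    unfolding smooth_near_def smooth_on_def
    by (intro exI[of _ S] conjI allI) (auto intro: Ck_on_cong[OF _ _ Ck_on_const])
qed

lemma smooth_near_imp_differentiable: "smooth_near f x \<Longrightarrow> f differentiable (at x)"
  unfolding smooth_near_def smooth_on_def by (metis Ck_on.simps(2))

lemma smooth_near_eventually_differentiable:
  "smooth_near f x \<Longrightarrow> \<forall>\<^sub>F y in nhds x. f differentiable (at y)"
  unfolding smooth_near_def smooth_on_def eventually_nhds by (metis Ck_on.simps(2))

lemma smooth_near_frechet_derivative_differentiable:
  "smooth_near f x \<Longrightarrow> (\<lambda>y. frechet_derivative f (at y) v) differentiable (at x)"
  unfolding smooth_near_def smooth_on_def by (metis Ck_on.simps(2))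

lemma smooth_near_frechet_derivative_commute:
  "smooth_near f x \<Longrightarrow>
    frechet_derivative (\<lambda>y. frechet_derivative f (at y) u) (at x) v =
    frechet_derivative (\<lambda>y. frechet_derivative f (at y) v) (at x) u"
  unfolding smooth_near_def smooth_on_def using frechet_derivative_commute by blast


subsection \<open>Charts\<close>

context
  fixes c :: "('m::topological_space, 'e::euclidean_space) pointed_atlas"
  assumes c: "smooth_atlas c"
begin

lemma cdom_self: "p \<in> cdom c p"
  using c by (simp add: smooth_atlas_def)

lemma cinv_cmap: "q \<in> cdom c p \<Longrightarrow> cinv c p (cmap c p q) = q"
  using c by (auto simp: smooth_atlas_def homeomorphism_def)

text \<open>The bridge from neighbourhoods on the manifold to neighbourhoods of coordinates, where
  derivatives live. \<open>cinv\<close> is meaningful only on the chart image, and this confines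
  attention to it.\<close>

lemma eventually_chart:
  assumes q: "q \<in> cdom c p" and P: "\<forall>\<^sub>F y in nhds q. P y"
  shows "\<forall>\<^sub>F z in nhds (cmap c p q).
    P (cinv c p z) \<and> cinv c p z \<in> cdom c p \<and> cmap c p (cinv c p z) = z"
proof -
  let ?I = "cmap c p ` cdom c p"
  have I: "open ?I" "continuous_on ?I (cinv c p)"
    "\<And>z. z \<in> ?I \<Longrightarrow> cinv c p z \<in> cdom c p \<and> cmap c p (cinv c p z) = z"
    using c by (auto simp: smooth_atlas_def homeomorphism_def)
  obtain O' where O': "open O'" "q \<in> O'" "\<And>y. y \<in> O' \<Longrightarrow> P y"
    using P by (auto simp: eventually_nhds)
  have "open (cinv c p -` O' \<inter> ?I)"
    using continuous_on_open_vimage[OF I(1)] I(2) O'(1) by blast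
  moreover have "cmap c p q \<in> cinv c p -` O' \<inter> ?I"
    using q O'(2) cinv_cmap by auto
  ultimately show ?thesis
    unfolding eventually_nhds using I(3) O'(3)
    by (intro exI[of _ "cinv c p -` O' \<inter> ?I"]) auto
qed

lemma eventually_in_cdom: "\<forall>\<^sub>F y in nhds p. y \<in> cdom c p"
  using c cdom_self by (auto simp: smooth_atlas_def eventually_nhds)

lemma has_derivative_tcoord_change:
  assumes "q \<in> cdom c a" "q \<in> cdom c b"
  shows "((cmap c b \<circ> cinv c a) has_derivative tcoord_change c a b q) (at (cmap c a q))"
proof -
  have "Ck_on (Suc 0) (cmap c b \<circ> cinv c a) (cmap c a ` (cdom c a \<inter> cdom c b))"
    using c unfolding smooth_atlas_def smooth_on_def by blast
  then have "(cmap c b \<circ> cinv c a) differentiable (at (cmap c a q))"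
    using assms by auto
  then show ?thesis
    unfolding tcoord_change_def by (simp add: frechet_derivative_works)
qed

lemma linear_tcoord_change:
  "q \<in> cdom c a \<Longrightarrow> q \<in> cdom c b \<Longrightarrow> linear (tcoord_change c a b q)"
  using has_derivative_tcoord_change has_derivative_linear by blast

lemma tcoord_change_self:
  assumes q: "q \<in> cdom c a" shows "tcoord_change c a a q = id"
proof -
  have "((\<lambda>z. z) has_derivative tcoord_change c a a q) (at (cmap c a q))"
    using has_derivative_tcoord_change[OF q q]
    by (rule has_derivative_cong_nhds)
       (use eventually_chart[OF q, of "\<lambda>_. True"] in \<open>auto elim: eventually_mono\<close>)
  from has_derivative_unique[OF this has_derivative_ident] show ?thesis by (auto simp: fun_eq_iff)
qed

lemma tcoord_change_compose:
  assumes q: "q \<in> cdom c a" "q \<in> cdom c b" "q \<in> cdom c d"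
  shows "tcoord_change c b d q (tcoord_change c a b q v) = tcoord_change c a d q v"
proof -
  have ca: "cinv c a (cmap c a q) = q" using q by (simp add: cinv_cmap)
  have "((\<lambda>x. (cmap c d \<circ> cinv c b) ((cmap c b \<circ> cinv c a) x)) has_derivative
      (\<lambda>v. tcoord_change c b d q (tcoord_change c a b q v))) (at (cmap c a q))"
    by (rule has_derivative_compose[OF has_derivative_tcoord_change[OF q(1,2)]])
       (use has_derivative_tcoord_change[OF q(2,3)] in \<open>simp add: ca o_def\<close>)
  moreover have "\<forall>\<^sub>F y in nhds q. y \<in> cdom c b"
    using c q(2) by (auto simp: smooth_atlas_def eventually_nhds)
  from eventually_chart[OF q(1) this]
  have "\<forall>\<^sub>F z in nhds (cmap c a q). (cmap c d \<circ> cinv c a) z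
      = (cmap c d \<circ> cinv c b) ((cmap c b \<circ> cinv c a) z)"
    by eventually_elim (simp add: cinv_cmap)
  ultimately have "((cmap c d \<circ> cinv c a) has_derivative
      (\<lambda>v. tcoord_change c b d q (tcoord_change c a b q v))) (at (cmap c a q))"
    by (rule has_derivative_cong_nhds)
  from has_derivative_unique[OF this has_derivative_tcoord_change[OF q(1,3)]]
  show ?thesis by (simp add: fun_eq_iff)
qed

lemma tcoord_change_inverse:
  "q \<in> cdom c a \<Longrightarrow> q \<in> cdom c b \<Longrightarrow> tcoord_change c b a q (tcoord_change c a b q v) = v"
  by (simp add: tcoord_change_compose tcoord_change_self)

end

section \<open>Metrics, maps and fields read in one fixed chart\<close>

text \<open>The coefficients g_ij of the metric in the chart around p. The coordinate changes are
  needed because \<open>g q\<close> expects components in the chart of q.\<close>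

definition metric_rep :: "('m, 'e::euclidean_space) pointed_atlas \<Rightarrow>
    ('m \<Rightarrow> 'e \<Rightarrow> 'e \<Rightarrow> real) \<Rightarrow> 'm \<Rightarrow> 'e \<Rightarrow> 'e \<Rightarrow> 'e \<Rightarrow> real" where
  "metric_rep c g p z u v =
     (let q = cinv c p z in g q (tcoord_change c p q q u) (tcoord_change c p q q v))"

text \<open>The extension of v with constant components in the chart around p, a combination of the
  coordinate fields there. It is the standard test field below.\<close>

definition coord_field :: "('m, 'e::euclidean_space) pointed_atlas \<Rightarrow> 'm \<Rightarrow> 'e \<Rightarrow> 'm \<Rightarrow> 'e" where
  "coord_field c p v = (\<lambda>q. tcoord_change c p q q v)"

definition inner_product :: "('e::euclidean_space \<Rightarrow> 'e \<Rightarrow> real) \<Rightarrow> bool" where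
  "inner_product b \<longleftrightarrow> bilinear b \<and> (\<forall>u v. b u v = b v u) \<and> (\<forall>v. v \<noteq> 0 \<longrightarrow> b v v > 0)"

text \<open>The identity map is an instance as well, so ordinary vector fields and fields along an
  immersion share one set of lemmas.\<close>

locale chart_map =
  fixes cP :: "('a::topological_space, 'd::euclidean_space) pointed_atlas"
    and c :: "('m::topological_space, 'e::euclidean_space) pointed_atlas"
    and F :: "'a \<Rightarrow> 'm"
  assumes cP: "smooth_atlas cP" and c: "smooth_atlas c"
    and F_cont: "continuous_on UNIV F"
    and F_diff: "\<And>p. (cmap c (F p) \<circ> F \<circ> cinv cP p) differentiable (at (cmap cP p p))"
begin

definition map_rep :: "'a \<Rightarrow> 'd \<Rightarrow> 'e" where
  "map_rep p = cmap c (F p) \<circ> F \<circ> cinv cP p"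

lemma mdiff_works: "(map_rep p has_derivative mdiff cP c F p) (at (cmap cP p p))"
  using F_diff[of p] by (simp add: map_rep_def mdiff_def frechet_derivative_works)

lemma linear_mdiff: "linear (mdiff cP c F p)"
  using mdiff_works has_derivative_linear by blast

lemma map_rep_self: "map_rep p (cmap cP p p) = cmap c (F p) (F p)"
  by (simp add: map_rep_def cinv_cmap[OF cP cdom_self[OF cP]])

lemma eventually_F:
  assumes "\<forall>\<^sub>F z in nhds (F p). P z"
  shows "\<forall>\<^sub>F y in nhds p. P (F y)"
proof -
  obtain S where "open S" "F p \<in> S" "\<And>y. y \<in> S \<Longrightarrow> P y"
    using assms by (auto simp: eventually_nhds)
  then show ?thesis
    unfolding eventually_nhds using F_cont
    by (intro exI[of _ "F -` S"]) (auto intro: open_vimage)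
qed

lemma eventually_in_cdoms: "\<forall>\<^sub>F y in nhds p. y \<in> cdom cP p \<and> F y \<in> cdom c (F p)"
  by (intro eventually_conj eventually_in_cdom[OF cP] eventually_F eventually_in_cdom[OF c])

lemma eventually_rep:
  assumes "\<And>y. y \<in> cdom cP p \<Longrightarrow> F y \<in> cdom c (F p) \<Longrightarrow> P y (cmap cP p y)"
  shows "\<forall>\<^sub>F x in nhds (cmap cP p p). P (cinv cP p x) x"
  using eventually_chart[OF cP cdom_self[OF cP] eventually_in_cdoms]
  by eventually_elim (metis assms)

text \<open>\<open>mdiff\<close> at y refers to the charts of y. Conjugated by coordinate changes it
  is the Jacobian of one fixed representation, which can be differentiated as y varies.\<close>

lemma has_derivative_map_rep:
  assumes y: "y \<in> cdom cP p" "F y \<in> cdom c (F p)"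
  shows "(map_rep p has_derivative
    (\<lambda>u. tcoord_change c (F y) (F p) (F y) (mdiff cP c F y (tcoord_change cP p y y u))))
    (at (cmap cP p y))"
proof -
  note ys = cdom_self[OF cP, of y] and Fys = cdom_self[OF c, of "F y"]
  note 1 = has_derivative_tcoord_change[OF cP y(1) ys]
  have 2: "(map_rep y has_derivative mdiff cP c F y) (at ((cmap cP y \<circ> cinv cP p) (cmap cP p y)))"
    using mdiff_works y by (simp add: cinv_cmap[OF cP])
  have 3: "((cmap c (F p) \<circ> cinv c (F y)) has_derivative tcoord_change c (F y) (F p) (F y))
      (at (map_rep y ((cmap cP y \<circ> cinv cP p) (cmap cP p y))))"
    using has_derivative_tcoord_change[OF c Fys y(2)] y by (simp add: cinv_cmap[OF cP] map_rep_self)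
  note D = has_derivative_compose[OF has_derivative_compose[OF 1 2] 3]
  have "\<forall>\<^sub>F x in nhds (cmap cP p y). map_rep p x =
    (cmap c (F p) \<circ> cinv c (F y)) (map_rep y ((cmap cP y \<circ> cinv cP p) x))"
    using eventually_chart[OF cP y(1) eventually_in_cdoms]
    by eventually_elim (simp add: map_rep_def cinv_cmap[OF cP] cinv_cmap[OF c])
  with D show ?thesis by (rule has_derivative_cong_nhds)
qed

lemma frechet_derivative_map_rep:
  assumes y: "y \<in> cdom cP p" "F y \<in> cdom c (F p)"
  shows "frechet_derivative (map_rep p) (at (cmap cP p y)) (tcoord_change cP y p y v)
    = tcoord_change c (F y) (F p) (F y) (mdiff cP c F y v)"
  using frechet_derivative_at[OF has_derivative_map_rep[OF y], symmetric]
  by (simp add: tcoord_change_inverse[OF cP cdom_self[OF cP] y(1)])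

definition rep :: "('a \<Rightarrow> 'e) \<Rightarrow> 'a \<Rightarrow> 'd \<Rightarrow> 'e" where
  "rep = field_rep cP c F"

lemma rep_cmap: "y \<in> cdom cP p \<Longrightarrow> rep V p (cmap cP p y) = tcoord_change c (F y) (F p) (F y) (V y)"
  by (simp add: rep_def field_rep_def cinv_cmap[OF cP])

lemma rep_self: "rep V p (cmap cP p p) = V p"
  by (simp add: rep_cmap cdom_self[OF cP] tcoord_change_self[OF c cdom_self[OF c]])

lemma eventually_rep_mdiff:
  "\<forall>\<^sub>F x in nhds (cmap cP p p). rep (\<lambda>y. mdiff cP c F y (Z y)) p x =
     frechet_derivative (map_rep p) (at x) (field_rep cP cP (\<lambda>q. q) Z p x)"
proof -
  have "\<forall>\<^sub>F x in nhds (cmap cP p p). rep (\<lambda>y. mdiff cP c F y (Z y)) p x =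
     frechet_derivative (map_rep p) (at x) (tcoord_change cP (cinv cP p x) p (cinv cP p x) (Z (cinv cP p x)))"
    by (rule eventually_rep) (simp add: rep_cmap frechet_derivative_map_rep)
  then show ?thesis by (simp add: field_rep_def Let_def)
qed

lemma metric_rep_map_rep:
  assumes y: "y \<in> cdom cP p" "F y \<in> cdom c (F p)"
  shows "metric_rep c g (F p) (map_rep p (cmap cP p y)) (rep V p (cmap cP p y)) (rep W p (cmap cP p y))
    = g (F y) (V y) (W y)"
  using y by (simp add: metric_rep_def map_rep_def cinv_cmap[OF cP] cinv_cmap[OF c] rep_cmap
     tcoord_change_inverse[OF c cdom_self[OF c] y(2)])

lemma eventually_metric_rep:
  "\<forall>\<^sub>F x in nhds (cmap cP p p). ((\<lambda>y. g (F y) (V y) (W y)) \<circ> cinv cP p) x =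
     metric_rep c g (F p) (map_rep p x) (rep V p x) (rep W p x)"
proof -
  have "\<forall>\<^sub>F x in nhds (cmap cP p p). g (F (cinv cP p x)) (V (cinv cP p x)) (W (cinv cP p x)) =
     metric_rep c g (F p) (map_rep p x) (rep V p x) (rep W p x)"
    by (rule eventually_rep) (simp add: metric_rep_map_rep)
  then show ?thesis by simp
qed

end

lemma bilinear_compose_linear:
  assumes "bilinear b" "linear L" "linear M" shows "bilinear (\<lambda>u v. b (L u) (M v))"
proof -
  have "linear (\<lambda>v. b (L u) (M v))" "linear (\<lambda>u. b (L u) (M v))" for u v
    using linear_compose[OF assms(3), of "b (L u)"] linear_compose[OF assms(2), of "\<lambda>u. b u (M v)"] assms(1)
    by (simp_all add: bilinear_def o_def)
  then show ?thesis by (simp add: bilinear_def)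
qed

lemma eventually_bilinear_metric_rep:
  assumes c: "smooth_atlas c" and g: "\<And>q. bilinear (g q)"
  shows "\<forall>\<^sub>F z in nhds (cmap c p p). bilinear (metric_rep c g p z)"
proof -
  have "\<forall>\<^sub>F z in nhds (cmap c p p). cinv c p z \<in> cdom c p"
    using eventually_chart[OF c cdom_self[OF c, of p], of "\<lambda>_. True"] by (auto elim: eventually_mono)
  then show ?thesis
  proof eventually_elim
    case (elim z)
    have "linear (tcoord_change c p (cinv c p z) (cinv c p z))"
      by (rule linear_tcoord_change[OF c elim cdom_self[OF c]])
    then show ?case
      unfolding metric_rep_def Let_def by (rule bilinear_compose_linear[OF g]) fact+
  qed
qed

subsection \<open>Inner products\<close>

lemma inner_product_bilinear: "inner_product b \<Longrightarrow> bilinear b"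
  and inner_product_commute: "inner_product b \<Longrightarrow> b u v = b v u"
  and inner_product_pos: "inner_product b \<Longrightarrow> v \<noteq> 0 \<Longrightarrow> b v v > 0"
  by (auto simp: inner_product_def)

lemma inner_product_eqI:
  assumes b: "inner_product b" and "\<And>w. b u w = b v w"
  shows "u = v"
proof (rule ccontr)
  assume "u \<noteq> v"
  then have "b (u - v) (u - v) > 0" using inner_product_pos[OF b] by simp
  then show False
    by (simp add: bilinear_lsub[OF inner_product_bilinear[OF b]] assms(2))
qed

text \<open>Positive definiteness makes t \<mapsto> (b t i) over the basis injective, hence onto in
  finite dimension. Christoffel maps and tangential parts are all obtained from this.\<close>

lemma inner_product_riesz:
  fixes b :: "'e::euclidean_space \<Rightarrow> 'e \<Rightarrow> real"
  assumes b: "inner_product b" and l: "linear l"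
  shows "\<exists>t. \<forall>w. b t w = l w"
proof -
  note bb = inner_product_bilinear[OF b]
  define A where "A = (\<lambda>t. \<Sum>i\<in>Basis. b t i *\<^sub>R i)"
  have A_inner: "A t \<bullet> i = b t i" if "i \<in> Basis" for t i
    using that by (simp add: A_def inner_sum_left inner_Basis if_distrib cong: if_cong)
  have lin: "linear A"
    unfolding A_def
    by (rule linearI) (simp_all add: bilinear_ladd[OF bb] bilinear_lmul[OF bb] scaleR_add_left
        sum.distrib scaleR_sum_right)
  have ext: "b t = l" if "\<And>i. i \<in> Basis \<Longrightarrow> b t i = l i" "linear l" for t l
    using linear_eq_stdbasis[of "b t" l] that bb by (auto simp: bilinear_def)
  have "inj A"
    unfolding linear_injective_0[OF lin]
  proof safe
    fix t assume "A t = 0"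
    then have "b t i = 0" if "i \<in> Basis" for i
      using A_inner[OF that, of t] by simp
    then have "b t = (\<lambda>_. 0)" by (intro ext) (auto intro: linear_zero)
    then show "t = 0" using inner_product_pos[OF b, of t] by fastforce
  qed
  then obtain t where t: "A t = (\<Sum>i\<in>Basis. l i *\<^sub>R i)"
    using linear_injective_imp_surjective[OF lin] by (metis surjD)
  have "b t i = l i" if "i \<in> Basis" for i
    using A_inner[OF that, of t] that by (simp add: t inner_sum_left inner_Basis if_distrib cong: if_cong)
  then show ?thesis using ext[OF _ l] by metis
qed

lemma inner_product_cauchy_schwarz:
  assumes b: "inner_product b"
  shows "(b u v)\<^sup>2 \<le> b u u * b v v"
proof (cases "v = 0")
  case True
  then show ?thesis by (simp add: bilinear_rzero[OF inner_product_bilinear[OF b]])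
next
  case False
  note bb = inner_product_bilinear[OF b]
  define r where "r = b u v / b v v"
  have v: "b v v > 0" using inner_product_pos[OF b False] .
  have "0 \<le> b (u - r *\<^sub>R v) (u - r *\<^sub>R v)"
    using inner_product_pos[OF b, of "u - r *\<^sub>R v"] bilinear_lzero[OF bb] by (cases "u - r *\<^sub>R v = 0") auto
  also have "\<dots> = b u u - 2 * r * b u v + r * r * b v v"
    using inner_product_commute[OF b, of v u]
    by (simp add: bilinear_lsub[OF bb] bilinear_rsub[OF bb] bilinear_lmul[OF bb] bilinear_rmul[OF bb] algebra_simps)
  also have "\<dots> = b u u - (b u v)\<^sup>2 / b v v"
    using v by (simp add: r_def power2_eq_square field_simps)
  finally show ?thesis using v by (simp add: field_simps)
qed

lemma inner_product_pullback:
  assumes b: "inner_product b" and L: "linear L" "inj L"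
  shows "inner_product (\<lambda>u v. b (L u) (L v))"
  unfolding inner_product_def
proof (intro conjI allI impI)
  show "bilinear (\<lambda>u v. b (L u) (L v))"
    by (rule bilinear_compose_linear[OF inner_product_bilinear[OF b] L(1) L(1)])
  show "b (L u) (L v) = b (L v) (L u)" for u v by (rule inner_product_commute[OF b])
  show "b (L v) (L v) > 0" if "v \<noteq> 0" for v
    using that L inner_product_pos[OF b] by (metis linear_0 injD)
qed

text \<open>Resolves the definite description in \<open>orth_proj\<close>: on the range of L the
  residual condition determines the vector, because the pullback of b along an injective L is again
  definite.\<close>

lemma orth_proj_eqI:
  fixes L :: "'d::euclidean_space \<Rightarrow> 'e::euclidean_space"
  assumes b: "inner_product b" and L: "linear L" "inj L"
    and t: "\<And>s. b (v - L t) (L s) = 0"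
  shows "orth_proj b (range L) v = L t"
  unfolding orth_proj_def
proof (rule the_equality)
  note bb = inner_product_bilinear[OF b]
  show "L t \<in> range L \<and> (\<forall>z\<in>range L. b (v - L t) z = 0)" using t by auto
  fix w assume w: "w \<in> range L \<and> (\<forall>z\<in>range L. b (v - w) z = 0)"
  then obtain r where r: "w = L r" by auto
  have "b (L r) (L s) = b (L t) (L s)" for s
    using w t[of s] by (auto simp: r bilinear_lsub[OF bb])
  then have "r = t" by (intro inner_product_eqI[OF inner_product_pullback[OF b L]]) auto
  then show "w = L t" by (simp add: r)
qed

lemma orth_proj_range:
  fixes L :: "'d::euclidean_space \<Rightarrow> 'e::euclidean_space"
  assumes b: "inner_product b" and L: "linear L" "inj L"
  shows "\<exists>t. orth_proj b (range L) v = L t \<and> (\<forall>s. b (v - L t) (L s) = 0)"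
proof -
  note bb = inner_product_bilinear[OF b]
  have "linear (\<lambda>s. b v (L s))"
    using linear_compose[OF L(1), of "b v"] bb by (simp add: bilinear_def o_def)
  then obtain t where "\<And>s. b (L t) (L s) = b v (L s)"
    using inner_product_riesz[OF inner_product_pullback[OF b L]] by blast
  then have t: "b (v - L t) (L s) = 0" for s by (simp add: bilinear_lsub[OF bb])
  show ?thesis using orth_proj_eqI[OF b L t] t by blast
qed


subsection \<open>Christoffel maps at a point\<close>

text \<open>The Levi-Civita conditions at a single point, in terms of metric coefficients instead of
  arbitrary fields. Existence and uniqueness become linear algebra.\<close>

definition lc_at :: "('m, 'e::euclidean_space) pointed_atlas \<Rightarrow>
    ('m \<Rightarrow> 'e \<Rightarrow> 'e \<Rightarrow> real) \<Rightarrow> 'm \<Rightarrow> ('e \<Rightarrow> 'e \<Rightarrow> 'e) \<Rightarrow> bool" where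
  "lc_at c g m G \<longleftrightarrow> bilinear G \<and> (\<forall>u v. G u v = G v u) \<and>
     (\<forall>u v. ((\<lambda>z. metric_rep c g m z u v) has_derivative (\<lambda>w. g m (G w u) v + g m u (G w v)))
        (at (cmap c m m)))"

context chart_map
begin

text \<open>Near p the function is a bilinear family evaluated at two component functions. The
  derivative of the family supplies exactly the Christoffel terms that complete the component
  derivatives to covariant ones.\<close>

lemma metric_leibniz:
  assumes g: "\<And>q. bilinear (g q)" and lc: "lc_at c g (F p) (\<Gamma> (F p))"
    and V: "rep V p differentiable (at (cmap cP p p))"
    and W: "rep W p differentiable (at (cmap cP p p))"
  shows "(((\<lambda>y. g (F y) (V y) (W y)) \<circ> cinv cP p) has_derivative
    (\<lambda>u. g (F p) (covd_along cP c \<Gamma> F V p u) (W p) + g (F p) (V p) (covd_along cP c \<Gamma> F W p u)))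
    (at (cmap cP p p))"
proof -
  let ?x = "cmap cP p p"
  obtain V' W' where V': "(rep V p has_derivative V') (at ?x)" and W': "(rep W p has_derivative W') (at ?x)"
    using V W by (auto simp: differentiable_def)
  have covV: "covd_along cP c \<Gamma> F V p u = V' u + \<Gamma> (F p) (mdiff cP c F p u) (V p)" for u
    using frechet_derivative_at[OF V', symmetric] by (simp add: covd_along_def rep_def)
  have covW: "covd_along cP c \<Gamma> F W p u = W' u + \<Gamma> (F p) (mdiff cP c F p u) (W p)" for u
    using frechet_derivative_at[OF W', symmetric] by (simp add: covd_along_def rep_def)
  have isc: "((map_rep p) \<longlongrightarrow> map_rep p ?x) (nhds ?x)"
    using has_derivative_continuous[OF mdiff_works[of p]]
    by (simp add: tendsto_at_iff_tendsto_nhds isCont_def)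
  have bil: "\<forall>\<^sub>F x in nhds ?x. bilinear (metric_rep c g (F p) (map_rep p x))"
    by (rule eventually_compose_filterlim[OF eventually_bilinear_metric_rep[where g=g and p="F p", OF c g]])
       (use isc in \<open>simp add: map_rep_self\<close>)
  have B': "((\<lambda>x. metric_rep c g (F p) (map_rep p x) u v) has_derivative
     (\<lambda>h. g (F p) (\<Gamma> (F p) (mdiff cP c F p h) u) v + g (F p) u (\<Gamma> (F p) (mdiff cP c F p h) v))) (at ?x)"
    for u v
    by (rule has_derivative_compose[OF mdiff_works])
       (use lc in \<open>simp add: lc_at_def map_rep_self\<close>)
  have self: "metric_rep c g (F p) (map_rep p ?x) u v = g (F p) u v" for u v
    by (simp add: map_rep_self metric_rep_def cinv_cmap[OF c cdom_self[OF c]]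
        tcoord_change_self[OF c cdom_self[OF c]])
  have "((\<lambda>x. metric_rep c g (F p) (map_rep p x) (rep V p x) (rep W p x)) has_derivative
    (\<lambda>u. g (F p) (covd_along cP c \<Gamma> F V p u) (W p) + g (F p) (V p) (covd_along cP c \<Gamma> F W p u)))
    (at (cmap cP p p))"
    using has_derivative_bilinear_family_apply[OF bil B' V' W']
    by (simp add: self rep_self covV covW bilinear_ladd[OF g] bilinear_radd[OF g] add_ac)
  then show ?thesis
    by (rule has_derivative_cong_nhds) (rule eventually_metric_rep)
qed

end

section \<open>The identity map and fields with constant components\<close>

lemma
  assumes c: "smooth_atlas c"
  shows chart_map_ident: "chart_map c c (\<lambda>q. q)"
    and mdiff_ident: "mdiff c c (\<lambda>q. q) p = id"
proof -
  have D: "((cmap c p \<circ> (\<lambda>q. q) \<circ> cinv c p) has_derivative id) (at (cmap c p p))" for p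
    using has_derivative_tcoord_change[OF c cdom_self[OF c] cdom_self[OF c], of p]
    by (simp add: tcoord_change_self[OF c cdom_self[OF c]] o_def)
  show "chart_map c c (\<lambda>q. q)"
    using c D by (auto simp: chart_map_def differentiable_def)
  show "mdiff c c (\<lambda>q. q) p = id"
    unfolding mdiff_def using frechet_derivative_at[OF D] by simp
qed

context
  fixes c :: "('m::topological_space, 'e::euclidean_space) pointed_atlas"
  assumes c: "smooth_atlas c"
begin

interpretation ident: chart_map c c "\<lambda>q. q"
  by (rule chart_map_ident[OF c])

lemma field_rep_coord_field:
  "\<forall>\<^sub>F x in nhds (cmap c p p). field_rep c c (\<lambda>q. q) (coord_field c p v) p x = v"
proof -
  have "\<forall>\<^sub>F x in nhds (cmap c p p). tcoord_change c (cinv c p x) p (cinv c p x) (coord_field c p v (cinv c p x)) = v"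
    by (rule ident.eventually_rep)
       (simp add: coord_field_def tcoord_change_inverse[OF c _ cdom_self[OF c]])
  then show ?thesis by (simp add: field_rep_def Let_def)
qed

lemma smooth_coord_field: "smooth_field_at c (coord_field c p v) p"
  unfolding smooth_field_at_def
  by (rule smooth_near_eventually_const) (rule field_rep_coord_field)

lemma coord_field_self: "coord_field c p v p = v"
  by (simp add: coord_field_def tcoord_change_self[OF c cdom_self[OF c]])

lemma frechet_derivative_coord_field:
  "frechet_derivative (field_rep c c (\<lambda>q. q) (coord_field c p v) p) (at (cmap c p p)) u = 0"
  using frechet_derivative_cong_nhds[OF field_rep_coord_field]
    frechet_derivative_at[OF has_derivative_const] by metis

lemma covd_coord_field: "covd c \<Gamma> (coord_field c p v) p u = \<Gamma> p u v"
  by (simp add: covd_def covd_along_def frechet_derivative_coord_field coord_field_self mdiff_ident[OF c])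

end

section \<open>Existence and uniqueness of the Levi-Civita connection\<close>

text \<open>Only differentiable coefficients are demanded, because that is what will be derived for
  the induced metric of a submanifold.\<close>

locale metric_atlas =
  fixes c :: "('m::topological_space, 'e::euclidean_space) pointed_atlas"
    and g :: "'m \<Rightarrow> 'e \<Rightarrow> 'e \<Rightarrow> real"
  assumes c: "smooth_atlas c" and ip: "\<And>q. inner_product (g q)"
    and g_diff: "\<And>p u v. (\<lambda>z. metric_rep c g p z u v) differentiable (at (cmap c p p))"
begin

sublocale ident: chart_map c c "\<lambda>q. q"
  by (rule chart_map_ident[OF c])

lemmas bil = inner_product_bilinear[OF ip]

text \<open>The classical formula for Christoffel symbols of the first kind. Its right side does not
  mention G, whence uniqueness.\<close>

lemma lc_koszul:
  assumes "lc_at c g p G"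
  shows "2 * g p (G u v) w =
    frechet_derivative (\<lambda>z. metric_rep c g p z v w) (at (cmap c p p)) u
    + frechet_derivative (\<lambda>z. metric_rep c g p z u w) (at (cmap c p p)) v
    - frechet_derivative (\<lambda>z. metric_rep c g p z u v) (at (cmap c p p)) w"
proof -
  have "((\<lambda>z. metric_rep c g p z a b) has_derivative (\<lambda>w. g p (G w a) b + g p a (G w b)))
      (at (cmap c p p))" for a b
    using assms by (simp add: lc_at_def)
  note D = frechet_derivative_at[OF this, symmetric]
  have "G u v = G v u" "G u w = G w u" "G v w = G w v" using assms by (auto simp: lc_at_def)
  then show ?thesis
    by (simp add: D inner_product_commute[OF ip, of p u] inner_product_commute[OF ip, of p v])
qed

lemma lc_unique: "lc_at c g p G \<Longrightarrow> lc_at c g p H \<Longrightarrow> G = H"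
proof (intro ext inner_product_eqI[OF ip[of p]])
  fix u v w assume "lc_at c g p G" "lc_at c g p H"
  then have "2 * g p (G u v) w = 2 * g p (H u v) w" by (simp only: lc_koszul)
  then show "g p (G u v) w = g p (H u v) w" by simp
qed

lemma lc_exists: "\<exists>G. lc_at c g p G"
proof -
  let ?x = "cmap c p p"
  define D where "D = (\<lambda>u v. frechet_derivative (\<lambda>z. metric_rep c g p z u v) (at ?x))"
  have D: "((\<lambda>z. metric_rep c g p z u v) has_derivative D u v) (at ?x)" for u v
    using g_diff[of p u v] by (simp add: D_def frechet_derivative_works)
  have linD: "linear (D u v)" for u v using D has_derivative_linear by blast
  have comm: "D u v = D v u" for u v
    unfolding D_def metric_rep_def by (simp add: Let_def inner_product_commute[OF ip])
  note ev = eventually_bilinear_metric_rep[where g=g and p=p, OF c bil]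
  \<comment> \<open>The coefficients are bilinear on a whole neighbourhood, so their derivatives
    inherit this by uniqueness.\<close>
  have add: "D (u + u') v w = D u v w + D u' v w" for u u' v w
  proof -
    have "((\<lambda>z. metric_rep c g p z (u + u') v) has_derivative (\<lambda>w. D u v w + D u' v w)) (at ?x)"
      by (rule has_derivative_cong_nhds[OF has_derivative_add[OF D D]])
         (use ev in eventually_elim, simp add: bilinear_ladd)
    then show ?thesis using has_derivative_unique[OF _ D] by metis
  qed
  have scale: "D (r *\<^sub>R u) v w = r * D u v w" for r u v w
  proof -
    have "((\<lambda>z. metric_rep c g p z (r *\<^sub>R u) v) has_derivative (\<lambda>w. r * D u v w)) (at ?x)"
      by (rule has_derivative_cong_nhds[OF has_derivative_mult_right[OF D]])
         (use ev in eventually_elim, simp add: bilinear_lmul)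
    then show ?thesis using has_derivative_unique[OF _ D] by metis
  qed
  have add2: "D v (u + u') w = D v u w + D v u' w" for u u' v w
    using add by (simp add: comm[of v])
  have scale2: "D v (r *\<^sub>R u) w = r * D v u w" for r u v w
    using scale by (simp add: comm[of v])
  note D_simps = add add2 scale scale2 linear_add[OF linD] linear_cmul[OF linD]
  have "\<exists>t. \<forall>w. g p t w = (D v w u + D u w v - D u v w) / 2" for u v
    by (rule inner_product_riesz[OF ip], rule linearI) (simp_all add: D_simps field_simps)
  note ex = this
  define G where "G = (\<lambda>u v. SOME t. \<forall>w. g p t w = (D v w u + D u w v - D u v w) / 2)"
  have G: "g p (G u v) w = (D v w u + D u w v - D u v w) / 2" for u v w
    using someI_ex[OF ex[of v u]] by (simp add: G_def)
  have G_sym: "G u v = G v u" for u v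
    by (rule inner_product_eqI[OF ip[of p]]) (simp add: G comm[of u v])
  have linG: "linear (\<lambda>u. G u v)" for v
    by (rule linearI; rule inner_product_eqI[OF ip[of p]])
       (simp_all add: bilinear_ladd[OF bil] bilinear_lmul[OF bil] G D_simps field_simps)
  moreover have "linear (G u)" for u
  proof -
    have "G u = (\<lambda>v. G v u)" using G_sym by auto
    then show ?thesis using linG[of u] by simp
  qed
  ultimately have "bilinear G" by (simp add: bilinear_def)
  moreover have "g p (G w u) v + g p u (G w v) = D u v w" for u v w
    unfolding inner_product_commute[OF ip, of p u "G w v"] G comm[of v u] by (simp add: field_simps)
  ultimately have "lc_at c g p G"
    unfolding lc_at_def using D by (intro conjI allI G_sym) auto
  then show ?thesis by blast
qed

lemma is_levi_civita_lc:
  assumes "\<And>p. lc_at c g p (\<Gamma> p)"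
  shows "is_levi_civita c g \<Gamma>"
  unfolding is_levi_civita_def
proof (intro conjI allI impI; (elim conjE)?)
  show "bilinear (\<Gamma> p)" for p using assms by (simp add: lc_at_def)
  show "covd c \<Gamma> Y p (X p) - covd c \<Gamma> X p (Y p) = lie_bracket c X Y p" for p X Y
    using assms[of p] by (simp add: covd_def covd_along_def lie_bracket_def mdiff_ident[OF c] lc_at_def)
  fix p u Y Z assume "smooth_field_at c Y p" "smooth_field_at c Z p"
  then have "ident.rep Y p differentiable (at (cmap c p p))" "ident.rep Z p differentiable (at (cmap c p p))"
    by (auto simp: smooth_field_at_def ident.rep_def intro: smooth_near_imp_differentiable)
  note D = ident.metric_leibniz[where g = g and \<Gamma> = \<Gamma>, OF bil assms this]
  show "frechet_derivative ((\<lambda>q. g q (Y q) (Z q)) \<circ> cinv c p) (at (cmap c p p)) u =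
       g p (covd c \<Gamma> Y p u) (Z p) + g p (Y p) (covd c \<Gamma> Z p u)"
    by (simp add: frechet_derivative_at[OF D, symmetric] covd_def)
qed

text \<open>Testing on \<open>coord_field\<close>s removes all derivatives of components: the
  bracket vanishes and covariant derivatives reduce to the Christoffel map.\<close>

lemma lc_is_levi_civita:
  assumes "is_levi_civita c g \<Gamma>"
  shows "lc_at c g p (\<Gamma> p)"
  unfolding lc_at_def
proof (intro conjI allI)
  show "bilinear (\<Gamma> p)" using assms by (simp add: is_levi_civita_def)
  note sm = smooth_coord_field[OF c, of p]
  fix u v
  have "covd c \<Gamma> (coord_field c p v) p (coord_field c p u p) - covd c \<Gamma> (coord_field c p u) p (coord_field c p v p)
    = lie_bracket c (coord_field c p u) (coord_field c p v) p"
    using assms sm unfolding is_levi_civita_def by blast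
  then show "\<Gamma> p u v = \<Gamma> p v u"
    by (simp add: covd_coord_field[OF c] lie_bracket_def frechet_derivative_coord_field[OF c] coord_field_self[OF c])
  have eq: "(\<lambda>z. metric_rep c g p z u v) = (\<lambda>q. g q (coord_field c p u q) (coord_field c p v q)) \<circ> cinv c p"
    by (auto simp: metric_rep_def coord_field_def Let_def)
  have "frechet_derivative (\<lambda>z. metric_rep c g p z u v) (at (cmap c p p)) w
    = g p (covd c \<Gamma> (coord_field c p u) p w) (coord_field c p v p)
      + g p (coord_field c p u p) (covd c \<Gamma> (coord_field c p v) p w)" for w
    using assms sm unfolding is_levi_civita_def eq by blast
  then have "frechet_derivative (\<lambda>z. metric_rep c g p z u v) (at (cmap c p p))
    = (\<lambda>w. g p (\<Gamma> p w u) v + g p u (\<Gamma> p w v))"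
    by (auto simp: covd_coord_field[OF c] coord_field_self[OF c])
  then show "((\<lambda>z. metric_rep c g p z u v) has_derivative (\<lambda>w. g p (\<Gamma> p w u) v + g p u (\<Gamma> p w v)))
     (at (cmap c p p))"
    using g_diff[of p u v] by (simp add: frechet_derivative_works)
qed

text \<open>\<open>levi_civita\<close> describes the connection at all points at once. The pointwise
  solutions are assembled into one candidate, and pointwise uniqueness makes it the only
  one.\<close>

lemma lc_levi_civita: "lc_at c g p (levi_civita c g p)"
proof -
  obtain \<Gamma> where \<Gamma>: "\<And>p. lc_at c g p (\<Gamma> p)" using lc_exists by metis
  have "\<Gamma>' = \<Gamma>" if "is_levi_civita c g \<Gamma>'" for \<Gamma>'
    using lc_unique[OF lc_is_levi_civita[OF that] \<Gamma>] by auto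
  then have "levi_civita c g = \<Gamma>"
    unfolding levi_civita_def using is_levi_civita_lc[OF \<Gamma>] by blast
  then show ?thesis using \<Gamma> by simp
qed

lemma levi_civita_eqI: "lc_at c g p G \<Longrightarrow> levi_civita c g p = G"
  by (rule lc_unique[OF lc_levi_civita])

end

lemma riemannian_metric_imp_metric_atlas:
  assumes "smooth_atlas c" "riemannian_metric c g"
  shows "metric_atlas c g"
proof
  show "inner_product (g q)" for q
    using assms(2) by (auto simp: riemannian_metric_def inner_product_def)
  have "smooth_near (\<lambda>z. metric_rep c g p z u v) (cmap c p p)" for p u v
    using assms(2) unfolding riemannian_metric_def metric_rep_def by blast
  then show "(\<lambda>z. metric_rep c g p z u v) differentiable (at (cmap c p p))" for p u v
    by (rule smooth_near_imp_differentiable)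
qed (rule assms)


subsection \<open>The second fundamental form in coordinates\<close>

locale riemannian_submanifold = chart_map cP c F + metric_atlas c g
  for cP :: "('a::topological_space, 'd::euclidean_space) pointed_atlas"
    and c :: "('m::topological_space, 'e::euclidean_space) pointed_atlas"
    and F :: "'a \<Rightarrow> 'm" and g :: "'m \<Rightarrow> 'e \<Rightarrow> 'e \<Rightarrow> real" +
  assumes smooth_rep: "\<And>p. smooth_near (map_rep p) (cmap cP p p)"
    and inj_mdiff: "\<And>p. inj (mdiff cP c F p)"
begin

abbreviation dF :: "'a \<Rightarrow> 'd \<Rightarrow> 'e" where "dF \<equiv> mdiff cP c F"

abbreviation D :: "('a \<Rightarrow> 'e) \<Rightarrow> 'a \<Rightarrow> 'd \<Rightarrow> 'e" where
  "D \<equiv> covd_along cP c (levi_civita c g) F"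

abbreviation diff_field :: "('a \<Rightarrow> 'e) \<Rightarrow> 'a \<Rightarrow> bool" where
  "diff_field V p \<equiv> rep V p differentiable (at (cmap cP p p))"

abbreviation field_deriv :: "('a \<Rightarrow> 'd) \<Rightarrow> 'a \<Rightarrow> 'd \<Rightarrow> 'd" where
  "field_deriv Z p \<equiv> frechet_derivative (field_rep cP cP (\<lambda>q. q) Z p) (at (cmap cP p p))"

abbreviation diff_tangent_field :: "('a \<Rightarrow> 'd) \<Rightarrow> 'a \<Rightarrow> bool" where
  "diff_tangent_field Z p \<equiv> field_rep cP cP (\<lambda>q. q) Z p differentiable (at (cmap cP p p))"

text \<open>\<open>B p u v\<close> is the ambient derivative in the direction \<open>u\<close> of the tangent field with constant
  components \<open>v\<close> in the chart around \<open>p\<close>; its normal part is the second fundamental form.\<close>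
definition B :: "'a \<Rightarrow> 'd \<Rightarrow> 'd \<Rightarrow> 'e" where
  "B p u v = frechet_derivative (\<lambda>x. frechet_derivative (map_rep p) (at x) v) (at (cmap cP p p)) u
     + levi_civita c g (F p) (dF p u) (dF p v)"

lemma bilinear_levi_civita: "bilinear (levi_civita c g q)"
  and levi_civita_commute: "levi_civita c g q u v = levi_civita c g q v u"
  using lc_levi_civita[of q] by (auto simp: lc_at_def)

text \<open>Second derivatives commute and the ambient connection is torsion-free. Unlike symmetry
  of the second fundamental form alone, this covers the tangential part too.\<close>

lemma B_commute: "B p u v = B p v u"
  unfolding B_def
  using smooth_near_frechet_derivative_commute[OF smooth_rep] levi_civita_commute by metis

lemma linear_B: "linear (B p u)"
proof -
  have "linear (\<lambda>u. frechet_derivative (\<lambda>x. frechet_derivative (map_rep p) (at x) v) (at (cmap cP p p)) u)" for v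
    using smooth_near_frechet_derivative_differentiable[OF smooth_rep]
    by (rule linear_frechet_derivative)
  moreover have "linear (\<lambda>u. levi_civita c g (F p) (dF p u) w)" for w
    using linear_compose[OF linear_mdiff, of "\<lambda>u. levi_civita c g (F p) u w"] bilinear_levi_civita[of "F p"]
    by (simp add: bilinear_def o_def)
  ultimately have "linear (\<lambda>u. B p u v)" for v
    unfolding B_def by (intro linear_compose_add) simp_all
  moreover have "B p u = (\<lambda>v. B p v u)" using B_commute by auto
  ultimately show ?thesis by simp
qed

lemma has_derivative_rep_tangent:
  assumes Z: "diff_tangent_field Z p"
  shows "(rep (\<lambda>y. dF y (Z y)) p has_derivative (\<lambda>u.
    frechet_derivative (\<lambda>x. frechet_derivative (map_rep p) (at x) (Z p)) (at (cmap cP p p)) u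
     + dF p (field_deriv Z p u))) (at (cmap cP p p))"
proof -
  let ?x = "cmap cP p p"
  have lin: "\<forall>\<^sub>F x in nhds ?x. linear (\<lambda>v. frechet_derivative (map_rep p) (at x) v)"
    using smooth_near_eventually_differentiable[OF smooth_rep]
    by eventually_elim (rule linear_frechet_derivative)
  have A': "((\<lambda>x. frechet_derivative (map_rep p) (at x) v) has_derivative
    frechet_derivative (\<lambda>x. frechet_derivative (map_rep p) (at x) v) (at ?x)) (at ?x)" for v
    using smooth_near_frechet_derivative_differentiable[OF smooth_rep] by (simp add: frechet_derivative_works)
  have V: "(field_rep cP cP (\<lambda>q. q) Z p has_derivative field_deriv Z p) (at ?x)"
    using Z by (simp add: frechet_derivative_works)
  have Zp: "field_rep cP cP (\<lambda>q. q) Z p ?x = Z p"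
    by (simp add: field_rep_def cinv_cmap[OF cP cdom_self[OF cP]] tcoord_change_self[OF cP cdom_self[OF cP]])
  have "frechet_derivative (map_rep p) (at ?x) = dF p"
    using frechet_derivative_at[OF mdiff_works] by simp
  then show ?thesis
    using has_derivative_cong_nhds[OF has_derivative_linear_family_apply[OF lin A' V] eventually_rep_mdiff]
    by (simp add: Zp)
qed

lemma diff_field_tangent: "diff_tangent_field Z p \<Longrightarrow> diff_field (\<lambda>y. dF y (Z y)) p"
  using has_derivative_rep_tangent unfolding differentiable_def by blast

text \<open>Separates a tensorial term from the derivative of the components. The latter is tangent,
  so it disappears under normal projection.\<close>

lemma D_tangent:
  assumes "diff_tangent_field Z p"
  shows "D (\<lambda>y. dF y (Z y)) p u = B p u (Z p) + dF p (field_deriv Z p u)"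
  using frechet_derivative_at[OF has_derivative_rep_tangent[OF assms], symmetric]
  by (simp add: covd_along_def B_def rep_def)

lemma diff_coord_field: "diff_tangent_field (coord_field cP p v) p"
  using smooth_coord_field[OF cP, of p v] by (simp add: smooth_field_at_def smooth_near_imp_differentiable)

lemma D_coord_field: "D (\<lambda>y. dF y (coord_field cP p v y)) p u = B p u v"
  by (simp add: D_tangent[OF diff_coord_field] frechet_derivative_coord_field[OF cP]
      coord_field_self[OF cP] linear_0[OF linear_mdiff])

lemma D_leibniz:
  assumes "diff_field V p" "diff_field W p"
  shows "(((\<lambda>y. g (F y) (V y) (W y)) \<circ> cinv cP p) has_derivative
    (\<lambda>u. g (F p) (D V p u) (W p) + g (F p) (V p) (D W p u))) (at (cmap cP p p))"
  using metric_leibniz[where g = g and \<Gamma> = "levi_civita c g", OF bil lc_levi_civita assms] .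

abbreviation gM :: "'a \<Rightarrow> 'd \<Rightarrow> 'd \<Rightarrow> real" where
  "gM \<equiv> induced_metric cP c g F"

text \<open>The coefficients of the induced metric are ambient inner products of pushed-forward
  constant fields, so the ambient Leibniz rule differentiates them.\<close>

lemma has_derivative_induced_metric_rep:
  "((\<lambda>x. metric_rep cP gM p x u v) has_derivative
    (\<lambda>w. g (F p) (B p w u) (dF p v) + g (F p) (dF p u) (B p w v))) (at (cmap cP p p))"
proof -
  have "(\<lambda>x. metric_rep cP gM p x u v) = (\<lambda>y. g (F y) (dF y (coord_field cP p u y))
      (dF y (coord_field cP p v y))) \<circ> cinv cP p"
    by (auto simp: metric_rep_def induced_metric_def coord_field_def Let_def)
  then show ?thesis
    using D_leibniz[OF diff_field_tangent[OF diff_coord_field] diff_field_tangent[OF diff_coord_field], of p u v]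
    by (simp add: D_coord_field coord_field_self[OF cP])
qed

lemma inner_product_induced: "inner_product (gM p)"
  unfolding induced_metric_def by (rule inner_product_pullback[OF ip linear_mdiff inj_mdiff])

sublocale M: metric_atlas cP gM
proof
  show "(\<lambda>z. metric_rep cP gM p z u v) differentiable (at (cmap cP p p))" for p u v
    using has_derivative_induced_metric_rep unfolding differentiable_def by blast
qed (rule cP inner_product_induced)+

text \<open>The Gauss formula: the tangential part of \<open>B\<close> is symmetric and satisfies
  the coefficient equation of the induced metric, so it must be the induced connection.\<close>

lemma levi_civita_induced:
  "g (F p) (dF p (levi_civita cP gM p u v)) (dF p w) = g (F p) (B p u v) (dF p w)"
proof -
  have "linear (\<lambda>w. g (F p) (B p u v) (dF p w))" for u v
    using linear_compose[OF linear_mdiff, of "g (F p) (B p u v)"] bil[of "F p"]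
    by (simp add: bilinear_def o_def)
  from inner_product_riesz[OF inner_product_induced this]
  have ex: "\<exists>t. \<forall>w. gM p t w = g (F p) (B p u v) (dF p w)" for u v by blast
  define G where "G = (\<lambda>u v. SOME t. \<forall>w. gM p t w = g (F p) (B p u v) (dF p w))"
  have G: "gM p (G u v) w = g (F p) (B p u v) (dF p w)" for u v w
    using someI_ex[OF ex[of u v]] by (simp add: G_def)
  have comm: "G u v = G v u" for u v unfolding G_def B_commute[of p u v] ..
  have lin: "linear (G u)" for u
    by (rule linearI; rule inner_product_eqI[OF inner_product_induced[of p]])
       (simp_all add: bilinear_ladd[OF M.bil] bilinear_lmul[OF M.bil] G linear_add[OF linear_B]
         linear_cmul[OF linear_B] bilinear_ladd[OF bil] bilinear_lmul[OF bil])
  have "(\<lambda>v. G v u) = G u" for u using comm by auto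
  then have "bilinear G" using lin by (simp add: bilinear_def)
  moreover have "g (F p) (B p w u) (dF p v) + g (F p) (dF p u) (B p w v) = gM p (G w u) v + gM p u (G w v)"
    for u v w
    using G[of w u v] G[of w v u] inner_product_commute[OF inner_product_induced, of p u "G w v"]
      inner_product_commute[OF ip, of "F p" "dF p u"] by simp
  then have "((\<lambda>z. metric_rep cP gM p z u v) has_derivative (\<lambda>w. gM p (G w u) v + gM p u (G w v)))
     (at (cmap cP p p))" for u v
    using has_derivative_induced_metric_rep[of p u v] by simp
  ultimately have "lc_at cP gM p G"
    unfolding lc_at_def by (intro conjI allI comm)
  then have "levi_civita cP gM p = G" by (rule M.levi_civita_eqI)
  then show ?thesis using G[of u v w] by (simp add: induced_metric_def)
qed

section \<open>Tangential and normal parts\<close>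

lemma tspace_eq: "tspace cP c F p = range (dF p)" by (simp add: tspace_def)

lemma normal_part_tangent: "normal_part cP c g F p (dF p u) = 0"
  using orth_proj_eqI[OF ip[of "F p"] linear_mdiff inj_mdiff, where v = "dF p u" and t = u]
  by (simp add: normal_part_def tspace_eq bilinear_lzero[OF bil])

lemma normal_part_normal: "g (F p) (normal_part cP c g F p v) (dF p w) = 0"
  using orth_proj_range[OF ip[of "F p"] linear_mdiff[of p] inj_mdiff[of p], where v = v]
  by (auto simp: normal_part_def tspace_eq)

lemma normal_part_in_nspace: "normal_part cP c g F p v \<in> nspace cP c g F p"
  using normal_part_normal by (auto simp: nspace_def tspace_eq)

lemma covd_eq: "covd cP (levi_civita cP gM) Z p u = field_deriv Z p u + levi_civita cP gM p u (Z p)"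
  by (simp add: covd_def covd_along_def mdiff_ident[OF cP])

text \<open>\<open>tang p v\<close> is the preimage under \<open>dF p\<close> of the tangential part of \<open>v\<close>.\<close>
definition tang :: "'a \<Rightarrow> 'e \<Rightarrow> 'd" where
  "tang p v = (SOME t. \<forall>w. gM p t w = g (F p) v (dF p w))"

lemma induced_tang: "gM p (tang p v) w = g (F p) v (dF p w)"
proof -
  have "linear (\<lambda>w. g (F p) v (dF p w))"
    using linear_compose[OF linear_mdiff, of "g (F p) v"] bil[of "F p"]
    by (simp add: bilinear_def o_def)
  from inner_product_riesz[OF inner_product_induced this]
  have ex: "\<exists>t. \<forall>w. gM p t w = g (F p) v (dF p w)" by blast
  show ?thesis using someI_ex[OF ex] by (simp add: tang_def)
qed

lemma inner_tang: "g (F p) (dF p (tang p v)) (dF p w) = g (F p) v (dF p w)"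
  using induced_tang by (simp add: induced_metric_def)

lemma linear_tang: "linear (tang p)"
  by (rule linearI; rule inner_product_eqI[OF inner_product_induced[of p]])
     (simp_all add: bilinear_ladd[OF M.bil] bilinear_lmul[OF M.bil] induced_tang
       bilinear_ladd[OF bil] bilinear_lmul[OF bil])

lemma normal_part_eq: "normal_part cP c g F p v = v - dF p (tang p v)"
  using orth_proj_eqI[OF ip[of "F p"] linear_mdiff[of p] inj_mdiff[of p], where v = v and t = "tang p v"]
  by (simp add: normal_part_def tspace_eq bilinear_lsub[OF bil] inner_tang)

lemma linear_normal_part: "linear (normal_part cP c g F p)"
  unfolding normal_part_eq
  using linear_compose_sub[OF linear_ident linear_compose[OF linear_tang linear_mdiff]] by (simp add: o_def)

text \<open>\<open>tang\<close> is a pointwise choice, but its components solve a linear system: the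
  Gram matrix of the coordinate fields against the inner products of V with them. Both are
  differentiable, and the matrix is injective. This makes N Z a differentiable field.\<close>

lemma diff_tang:
  assumes V: "diff_field V p"
  shows "diff_tangent_field (\<lambda>y. tang y (V y)) p"
proof (rule differentiable_linear_solution)
  let ?x = "cmap cP p p"
  let ?A = "\<lambda>x v. \<Sum>i\<in>Basis. metric_rep cP gM p x v i *\<^sub>R i"
  let ?b = "\<lambda>x. \<Sum>i\<in>Basis. (((\<lambda>y. g (F y) (V y) (dF y (coord_field cP p i y))) \<circ> cinv cP p) x) *\<^sub>R i"
  have bil_ev: "\<forall>\<^sub>F x in nhds ?x. bilinear (metric_rep cP gM p x)"
    by (rule eventually_bilinear_metric_rep[OF cP M.bil])
  then show "\<forall>\<^sub>F x in nhds ?x. linear (?A x)"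
    by eventually_elim
       (auto intro!: linearI simp: bilinear_ladd bilinear_lmul scaleR_add_left sum.distrib scaleR_sum_right)
  show "(\<lambda>x. ?A x v) differentiable (at ?x)" for v
    using M.g_diff by (intro differentiable_sum differentiable_scaleR) simp_all
  have self: "metric_rep cP gM p ?x u v = gM p u v" for u v
    by (simp add: metric_rep_def cinv_cmap[OF cP cdom_self[OF cP]] tcoord_change_self[OF cP cdom_self[OF cP]])
  have lin: "linear (?A ?x)"
    by (rule linearI) (simp_all add: self bilinear_ladd[OF M.bil] bilinear_lmul[OF M.bil]
       scaleR_add_left sum.distrib scaleR_sum_right)
  show "inj (?A ?x)"
    unfolding linear_injective_0[OF lin]
  proof safe
    fix v assume v: "?A ?x v = 0"
    have "gM p v i = 0" if "i \<in> Basis" for i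
      using arg_cong[OF v, of "\<lambda>w. w \<bullet> i"] that
      by (simp add: self inner_sum_left inner_Basis if_distrib cong: if_cong)
    moreover have "linear (gM p v)" using M.bil[of p] by (simp add: bilinear_def)
    ultimately have "gM p v = (\<lambda>_. 0)" by (intro linear_eq_stdbasis linear_zero) auto
    then show "v = 0" using inner_product_pos[OF inner_product_induced, of v p] by fastforce
  qed
  show "?b differentiable (at ?x)"
  proof (intro differentiable_sum finite_Basis ballI)
    fix i :: 'd
    have "((\<lambda>y. g (F y) (V y) (dF y (coord_field cP p i y))) \<circ> cinv cP p) differentiable (at ?x)"
      using D_leibniz[OF V diff_field_tangent[OF diff_coord_field]] unfolding differentiable_def by blast
    then show "(\<lambda>x. ((\<lambda>y. g (F y) (V y) (dF y (coord_field cP p i y))) \<circ> cinv cP p) x *\<^sub>R i)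
        differentiable (at ?x)"
      by (rule differentiable_scaleR) (rule differentiable_const)
  qed
  have "\<forall>\<^sub>F x in nhds ?x. ?A x (tcoord_change cP (cinv cP p x) p (cinv cP p x) (tang (cinv cP p x) (V (cinv cP p x)))) = ?b x"
  proof (rule eventually_mono[OF eventually_rep])
    show "cinv cP p x \<in> cdom cP p \<Longrightarrow> ?A x (tcoord_change cP (cinv cP p x) p (cinv cP p x) (tang (cinv cP p x) (V (cinv cP p x)))) = ?b x" for x
      by (simp add: metric_rep_def Let_def tcoord_change_inverse[OF cP cdom_self[OF cP]] induced_tang coord_field_def)
  qed simp
  then show "\<forall>\<^sub>F x in nhds ?x. ?A x (field_rep cP cP (\<lambda>q. q) (\<lambda>y. tang y (V y)) p x) = ?b x"
    by (simp add: field_rep_def Let_def)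
qed

lemma D_diff:
  assumes V: "diff_field V p" and W: "diff_field W p"
  shows "D (\<lambda>y. V y - W y) p u = D V p u - D W p u"
proof -
  obtain V' W' where VW: "(rep V p has_derivative V') (at (cmap cP p p))" "(rep W p has_derivative W') (at (cmap cP p p))"
    using V W by (auto simp: differentiable_def)
  have "\<forall>\<^sub>F x in nhds (cmap cP p p). rep (\<lambda>y. V y - W y) p x = rep V p x - rep W p x"
    by (rule eventually_rep)
       (simp add: rep_cmap linear_diff[OF linear_tcoord_change[OF c cdom_self[OF c]]])
  from has_derivative_cong_nhds[OF has_derivative_diff[OF VW] this]
  have VW': "(rep (\<lambda>y. V y - W y) p has_derivative (\<lambda>h. V' h - W' h)) (at (cmap cP p p))" .
  show "D (\<lambda>y. V y - W y) p u = D V p u - D W p u"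
    using VW[THEN frechet_derivative_at, symmetric] VW'[THEN frechet_derivative_at, symmetric]
    by (simp add: covd_along_def rep_def bilinear_rsub[OF bilinear_levi_civita])
qed

end


subsection \<open>Submanifolds of Kenmotsu manifolds\<close>

locale kenmotsu_submanifold = riemannian_submanifold cP c F g
  for cP :: "('a::topological_space, 'd::euclidean_space) pointed_atlas"
    and c :: "('m::topological_space, 'e::euclidean_space) pointed_atlas"
    and F :: "'a \<Rightarrow> 'm" and g :: "'m \<Rightarrow> 'e \<Rightarrow> 'e \<Rightarrow> real" +
  fixes \<phi> :: "'m \<Rightarrow> 'e \<Rightarrow> 'e" and \<xi> :: "'m \<Rightarrow> 'e" and \<eta> :: "'m \<Rightarrow> 'e \<Rightarrow> real"
  assumes kenmotsu: "kenmotsu_manifold c \<phi> \<xi> \<eta> g"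
begin

lemma contact: "almost_contact_metric_structure c \<phi> \<xi> \<eta> g"
  using kenmotsu by (simp add: kenmotsu_manifold_def)

lemma linear_phi: "linear (\<phi> q)"
  using contact by (auto simp: almost_contact_metric_structure_def smooth_endomorphism_field_def)

lemma phi_skew: "g q (\<phi> q u) v = - g q u (\<phi> q v)"
  and g_xi: "g q u (\<xi> q) = \<eta> q u"
  and g_phi_phi: "g q (\<phi> q u) (\<phi> q v) = g q u v - \<eta> q u * \<eta> q v"
  and eta_phi: "\<eta> q (\<phi> q u) = 0"
proof -
  have *: "\<eta> q (\<phi> q u) = 0 \<and> g q u (\<xi> q) = \<eta> q u"
    using contact unfolding almost_contact_metric_structure_def by blast
  have **: "g q u v = g q (\<phi> q u) (\<phi> q v) + \<eta> q u * \<eta> q v \<and> g q u (\<phi> q v) = - g q (\<phi> q u) v"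
    using contact unfolding almost_contact_metric_structure_def by blast
  show "g q (\<phi> q u) v = - g q u (\<phi> q v)" "g q (\<phi> q u) (\<phi> q v) = g q u v - \<eta> q u * \<eta> q v"
    using ** by linarith+
  show "g q u (\<xi> q) = \<eta> q u" "\<eta> q (\<phi> q u) = 0"
    using * by blast+
qed

text \<open>The matrix of \<phi> in the chart around m.\<close>

definition phi_rep :: "'m \<Rightarrow> 'e \<Rightarrow> 'e \<Rightarrow> 'e" where
  "phi_rep m z v =
     (let q = cinv c m z in tcoord_change c q m q (\<phi> q (tcoord_change c m q q v)))"

text \<open>The Kenmotsu identity on fields with constant components, solved for the derivative of
  the matrix of \<phi>.\<close>

lemma has_derivative_phi_rep:
  "((\<lambda>z. phi_rep m z v) has_derivative (\<lambda>w. \<phi> m (levi_civita c g m w v) - levi_civita c g m w (\<phi> m v)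
     + g m (\<phi> m w) v *\<^sub>R \<xi> m - \<eta> m v *\<^sub>R \<phi> m w)) (at (cmap c m m))"
proof -
  have "(\<lambda>z. phi_rep m z v) differentiable (at (cmap c m m))"
    using contact unfolding almost_contact_metric_structure_def smooth_endomorphism_field_def phi_rep_def
    by (intro smooth_near_imp_differentiable) blast
  then have D: "((\<lambda>z. phi_rep m z v) has_derivative frechet_derivative (\<lambda>z. phi_rep m z v) (at (cmap c m m)))
      (at (cmap c m m))"
    by (simp add: frechet_derivative_works)
  have rep: "field_rep c c (\<lambda>q. q) (\<lambda>q. \<phi> q (coord_field c m v q)) m = (\<lambda>z. phi_rep m z v)"
    by (auto simp: field_rep_def phi_rep_def coord_field_def Let_def)
  have "frechet_derivative (\<lambda>z. phi_rep m z v) (at (cmap c m m)) w + levi_civita c g m w (\<phi> m v)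
      - \<phi> m (levi_civita c g m w v) = g m (\<phi> m w) v *\<^sub>R \<xi> m - \<eta> m v *\<^sub>R \<phi> m w" for w
  proof -
    have "covd c (levi_civita c g) (\<lambda>q. \<phi> q (coord_field c m v q)) m w
       - \<phi> m (covd c (levi_civita c g) (coord_field c m v) m w)
        = g m (\<phi> m w) (coord_field c m v m) *\<^sub>R \<xi> m - \<eta> m (coord_field c m v m) *\<^sub>R \<phi> m w"
      using kenmotsu smooth_coord_field[OF c, of m v] unfolding kenmotsu_manifold_def by blast
    then show ?thesis
      unfolding covd_coord_field[OF c] coord_field_self[OF c]
      by (simp add: covd_def covd_along_def rep mdiff_ident[OF c] coord_field_self[OF c])
  qed
  then have "frechet_derivative (\<lambda>z. phi_rep m z v) (at (cmap c m m)) =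
    (\<lambda>w. \<phi> m (levi_civita c g m w v) - levi_civita c g m w (\<phi> m v)
     + g m (\<phi> m w) v *\<^sub>R \<xi> m - \<eta> m v *\<^sub>R \<phi> m w)"
    by (auto simp: fun_eq_iff algebra_simps)
  then show ?thesis using D by simp
qed

text \<open>Transfers the Kenmotsu identity from ambient fields to fields along \<open>F\<close>
  that are merely differentiable at p, such as \<phi> Z on the submanifold.\<close>

lemma
  assumes V: "diff_field V p"
  shows diff_field_phi: "diff_field (\<lambda>y. \<phi> (F y) (V y)) p"
    and D_phi: "D (\<lambda>y. \<phi> (F y) (V y)) p u = \<phi> (F p) (D V p u)
      + g (F p) (\<phi> (F p) (dF p u)) (V p) *\<^sub>R \<xi> (F p) - \<eta> (F p) (V p) *\<^sub>R \<phi> (F p) (dF p u)"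
proof -
  let ?x = "cmap cP p p" and ?m = "F p"
  obtain V' where V': "(rep V p has_derivative V') (at ?x)" using V by (auto simp: differentiable_def)
  have lin: "\<forall>\<^sub>F x in nhds ?x. linear (phi_rep ?m (map_rep p x))"
  proof (rule eventually_mono[OF eventually_rep])
    fix x assume "F (cinv cP p x) \<in> cdom c ?m"
    then show "linear (phi_rep ?m (map_rep p x))"
      unfolding phi_rep_def map_rep_def Let_def o_def cinv_cmap[OF c \<open>F (cinv cP p x) \<in> cdom c ?m\<close>]
      using linear_compose[OF linear_compose[OF linear_tcoord_change[OF c _ cdom_self[OF c]] linear_phi]
         linear_tcoord_change[OF c cdom_self[OF c]]] by (simp add: o_def)
  qed
  have A': "((\<lambda>x. phi_rep ?m (map_rep p x) v) has_derivative
     (\<lambda>u. \<phi> ?m (levi_civita c g ?m (dF p u) v) - levi_civita c g ?m (dF p u) (\<phi> ?m v)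
     + g ?m (\<phi> ?m (dF p u)) v *\<^sub>R \<xi> ?m - \<eta> ?m v *\<^sub>R \<phi> ?m (dF p u))) (at ?x)" for v
    by (rule has_derivative_compose[OF mdiff_works]) (simp add: map_rep_self has_derivative_phi_rep)
  have D1: "((\<lambda>x. phi_rep ?m (map_rep p x) (rep V p x)) has_derivative
     (\<lambda>u. \<phi> ?m (levi_civita c g ?m (dF p u) (V p)) - levi_civita c g ?m (dF p u) (\<phi> ?m (V p))
     + g ?m (\<phi> ?m (dF p u)) (V p) *\<^sub>R \<xi> ?m - \<eta> ?m (V p) *\<^sub>R \<phi> ?m (dF p u)
     + phi_rep ?m (map_rep p ?x) (V' u))) (at ?x)"
    using has_derivative_linear_family_apply[OF lin A' V']
    by (simp only: rep_self)
  have self: "phi_rep ?m (map_rep p ?x) v = \<phi> ?m v" for v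
    by (simp add: phi_rep_def map_rep_self cinv_cmap[OF c cdom_self[OF c]] tcoord_change_self[OF c cdom_self[OF c]])
  have "\<forall>\<^sub>F x in nhds ?x. rep (\<lambda>y. \<phi> (F y) (V y)) p x = phi_rep ?m (map_rep p x) (rep V p x)"
    by (rule eventually_rep)
       (simp add: Let_def rep_cmap phi_rep_def map_rep_def cinv_cmap[OF c] cinv_cmap[OF cP]
         tcoord_change_inverse[OF c cdom_self[OF c]])
  note D2 = has_derivative_cong_nhds[OF D1 this]
  then show "diff_field (\<lambda>y. \<phi> (F y) (V y)) p" by (auto simp: differentiable_def)
  show "D (\<lambda>y. \<phi> (F y) (V y)) p u = \<phi> (F p) (D V p u)
      + g (F p) (\<phi> (F p) (dF p u)) (V p) *\<^sub>R \<xi> (F p) - \<eta> (F p) (V p) *\<^sub>R \<phi> (F p) (dF p u)"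
    using frechet_derivative_at[OF D2, symmetric] frechet_derivative_at[OF V', symmetric]
    by (simp add: covd_along_def rep_def self linear_add[OF linear_phi])
qed

abbreviation nor :: "'a \<Rightarrow> 'e \<Rightarrow> 'e" where "nor \<equiv> normal_part cP c g F"

abbreviation T :: "'a \<Rightarrow> 'd \<Rightarrow> 'd" where "T p u \<equiv> tang p (\<phi> (F p) (dF p u))"

lemma N_op_eq: "N_op cP c \<phi> g F p u = \<phi> (F p) (dF p u) - dF p (T p u)"
  by (simp add: N_op_def normal_part_eq)

text \<open>N is \<phi> dF - dF T; each summand is differentiated separately. The first argument of
  \<phi> on the right is the second fundamental form of X and Z by the Gauss formula.\<close>

lemma covd_N_eq:
  assumes Z: "diff_tangent_field Z p"
  shows "covd_N cP c \<phi> g F X Z p = nor p (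
      \<phi> (F p) (B p (X p) (Z p) - dF p (levi_civita cP gM p (X p) (Z p)))
      + g (F p) (\<phi> (F p) (dF p (X p))) (dF p (Z p)) *\<^sub>R \<xi> (F p)
      - \<eta> (F p) (dF p (Z p)) *\<^sub>R \<phi> (F p) (dF p (X p)) - B p (X p) (T p (Z p)))"
proof -
  note dV = diff_field_tangent[OF Z]
  note dphi = diff_field_phi[OF dV]
  note dT = diff_tang[OF dphi]
  have "D (\<lambda>y. N_op cP c \<phi> g F y (Z y)) p (X p) = \<phi> (F p) (B p (X p) (Z p) + dF p (field_deriv Z p (X p)))
      + g (F p) (\<phi> (F p) (dF p (X p))) (dF p (Z p)) *\<^sub>R \<xi> (F p)
      - \<eta> (F p) (dF p (Z p)) *\<^sub>R \<phi> (F p) (dF p (X p))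
      - (B p (X p) (T p (Z p)) + dF p (field_deriv (\<lambda>y. T y (Z y)) p (X p)))"
    unfolding N_op_eq D_diff[OF dphi diff_field_tangent[OF dT]] D_phi[OF dV] D_tangent[OF Z] D_tangent[OF dT] ..
  \<comment> \<open>The component derivative of Z cancels against N(\<nabla>_X Z), and that of T Z
    is tangent, so no derivative of either field survives.\<close>
  then show ?thesis
    unfolding covd_N_def normal_connection_def covd_eq N_op_def
    by (simp add: linear_add[OF linear_mdiff] linear_add[OF linear_phi] linear_diff[OF linear_phi]
      linear_add[OF linear_normal_part] linear_diff[OF linear_normal_part] normal_part_tangent)
qed

end

subsection \<open>Product atlases\<close>

lemma cdom_prod_atlas: "y \<in> cdom (prod_atlas c1 c2) x \<longleftrightarrow> fst y \<in> cdom c1 (fst x) \<and> snd y \<in> cdom c2 (snd x)"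
  by (cases x; cases y) (simp add: prod_atlas_def cdom_def)

lemma cmap_prod_atlas: "cmap (prod_atlas c1 c2) x y = (cmap c1 (fst x) (fst y), cmap c2 (snd x) (snd y))"
  by (cases x; cases y) (simp add: prod_atlas_def cmap_def)

text \<open>\<open>cinv\<close> of the product is a chosen inverse, so it splits into factors only
  on the chart image. Hence the comparison of the two maps near the point is made at z =
  \<open>cmap ?c a w\<close>.\<close>

lemma tcoord_change_prod_atlas:
  assumes atlas: "smooth_atlas c1" "smooth_atlas c2" "smooth_atlas (prod_atlas c1 c2)"
    and y: "y \<in> cdom (prod_atlas c1 c2) a" "y \<in> cdom (prod_atlas c1 c2) b"
  shows "tcoord_change (prod_atlas c1 c2) a b y u =
    (tcoord_change c1 (fst a) (fst b) (fst y) (fst u), tcoord_change c2 (snd a) (snd b) (snd y) (snd u))"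
proof -
  let ?c = "prod_atlas c1 c2"
  have y': "fst y \<in> cdom c1 (fst a)" "fst y \<in> cdom c1 (fst b)" "snd y \<in> cdom c2 (snd a)" "snd y \<in> cdom c2 (snd b)"
    using y by (auto simp: cdom_prod_atlas)
  have 1: "(fst has_derivative fst) (at z)" "(snd has_derivative snd) (at z)"
    for z :: "'x::real_normed_vector \<times> 'y::real_normed_vector"
    using has_derivative_fst[OF has_derivative_ident] has_derivative_snd[OF has_derivative_ident] by auto
  have "((\<lambda>z. ((cmap c1 (fst b) \<circ> cinv c1 (fst a)) (fst z), (cmap c2 (snd b) \<circ> cinv c2 (snd a)) (snd z))) has_derivative
    (\<lambda>u. (tcoord_change c1 (fst a) (fst b) (fst y) (fst u), tcoord_change c2 (snd a) (snd b) (snd y) (snd u))))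
    (at (cmap ?c a y))"
    by (rule has_derivative_Pair; rule has_derivative_compose[OF 1(1)] has_derivative_compose[OF 1(2)];
        simp add: cmap_prod_atlas has_derivative_tcoord_change atlas y' del: o_apply)
  moreover have "\<forall>\<^sub>F z in nhds (cmap ?c a y). (cmap ?c b \<circ> cinv ?c a) z =
      ((cmap c1 (fst b) \<circ> cinv c1 (fst a)) (fst z), (cmap c2 (snd b) \<circ> cinv c2 (snd a)) (snd z))"
    using eventually_chart[OF atlas(3) y(1), of "\<lambda>_. True", simplified]
  proof eventually_elim
    case (elim z)
    define w where "w = cinv ?c a z"
    have w: "fst w \<in> cdom c1 (fst a)" "snd w \<in> cdom c2 (snd a)" and z: "z = cmap ?c a w"
      using elim by (auto simp: cdom_prod_atlas w_def)
    have "cinv ?c a z = w" by (simp add: w_def)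
    then show ?case
      using w by (simp add: z cmap_prod_atlas cinv_cmap[OF atlas(1)] cinv_cmap[OF atlas(2)])
  qed
  ultimately have "((cmap ?c b \<circ> cinv ?c a) has_derivative
    (\<lambda>u. (tcoord_change c1 (fst a) (fst b) (fst y) (fst u), tcoord_change c2 (snd a) (snd b) (snd y) (snd u))))
    (at (cmap ?c a y))"
    by (rule has_derivative_cong_nhds)
  from has_derivative_unique[OF this has_derivative_tcoord_change[OF atlas(3) y]]
  show ?thesis by (metis (no_types, lifting))
qed


subsection \<open>Warped product submanifolds\<close>

locale warped_kenmotsu_submanifold = kenmotsu_submanifold "prod_atlas cT cS" c F g \<phi> \<xi> \<eta>
  for cT :: "('a::topological_space, 'ea::euclidean_space) pointed_atlas"
    and cS :: "('b::topological_space, 'eb::euclidean_space) pointed_atlas"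
    and c :: "('m::topological_space, 'e::euclidean_space) pointed_atlas"
    and F :: "'a \<times> 'b \<Rightarrow> 'm" and g \<phi> \<xi> \<eta> +
  fixes gT :: "'a \<Rightarrow> 'ea \<Rightarrow> 'ea \<Rightarrow> real" and gS :: "'b \<Rightarrow> 'eb \<Rightarrow> 'eb \<Rightarrow> real" and f :: "'a \<Rightarrow> real"
  assumes cT: "smooth_atlas cT" and gT: "riemannian_metric cT gT"
    and cS: "smooth_atlas cS" and gS: "riemannian_metric cS gS"
    and f_smooth: "smooth_fun cT f" and f_pos: "\<And>p. f p > 0"
    and gM_eq: "gM = warped_metric gT f gS"
    and xi_tangent: "\<exists>a. \<xi> (F x) = dF x (a, 0)"
    and phi_invariant: "\<exists>b. \<phi> (F x) (dF x (a, 0)) = dF x (b, 0)"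
begin

abbreviation cM where "cM \<equiv> prod_atlas cT cS"

sublocale mT: metric_atlas cT gT by (rule riemannian_metric_imp_metric_atlas[OF cT gT])
sublocale mS: metric_atlas cS gS by (rule riemannian_metric_imp_metric_atlas[OF cS gS])

definition dlnf :: "'a \<times> 'b \<Rightarrow> 'ea \<Rightarrow> real" where
  "dlnf x a = frechet_derivative (f \<circ> cinv cT (fst x)) (at (cmap cT (fst x) (fst x))) a / f (fst x)"

lemma gM_apply: "g (F x) (dF x u) (dF x v) = gT (fst x) (fst u) (fst v) + (f (fst x))\<^sup>2 * gS (snd x) (snd u) (snd v)"
  using fun_cong[OF fun_cong[OF fun_cong[OF gM_eq, of x], of u], of v]
  by (simp add: induced_metric_def warped_metric_def)

lemma gM_mixed: "g (F x) (dF x (a, 0)) (dF x (0, z)) = 0" "g (F x) (dF x (0, z)) (dF x (a, 0)) = 0"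
  by (simp_all add: gM_apply bilinear_rzero[OF mT.bil] bilinear_lzero[OF mS.bil]
     bilinear_rzero[OF mS.bil] bilinear_lzero[OF mT.bil])

lemma coord_field_prod:
  "y \<in> cdom cM x \<Longrightarrow> coord_field cM x (a, z) y = (coord_field cT (fst x) a (fst y), coord_field cS (snd x) z (snd y))"
  using tcoord_change_prod_atlas[OF cT cS cP _ cdom_self[OF cP], of y x "(a, z)"]
  by (simp add: coord_field_def)

lemma coord_field_zero:
  assumes "y \<in> cdom cM x"
  shows "coord_field cT (fst x) 0 (fst y) = 0" "coord_field cS (snd x) 0 (snd y) = 0"
  using assms linear_0[OF linear_tcoord_change[OF cT _ cdom_self[OF cT]]]
    linear_0[OF linear_tcoord_change[OF cS _ cdom_self[OF cS]]]
  by (simp_all add: coord_field_def cdom_prod_atlas)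

text \<open>The derivative of one metric coefficient computed twice: by the ambient connection, and
  by the product rule for gT + f^2 gS. All Koszul-type identities for the warped metric are
  specialisations of it.\<close>

lemma warped_derivative:
  "g (F x) (B x w u) (dF x v) + g (F x) (dF x u) (B x w v) =
    (gT (fst x) (levi_civita cT gT (fst x) (fst w) (fst u)) (fst v) + gT (fst x) (fst u) (levi_civita cT gT (fst x) (fst w) (fst v)))
    + 2 * dlnf x (fst w) * ((f (fst x))\<^sup>2 * gS (snd x) (snd u) (snd v))
    + (f (fst x))\<^sup>2 * (gS (snd x) (levi_civita cS gS (snd x) (snd w) (snd u)) (snd v) + gS (snd x) (snd u) (levi_civita cS gS (snd x) (snd w) (snd v)))"
proof -
  let ?p = "fst x" and ?q = "snd x"
  let ?h = "f \<circ> cinv cT ?p" and ?xi = "cmap cM x x"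
  let ?h' = "frechet_derivative ?h (at (cmap cT ?p ?p))"
  have h: "(?h has_derivative ?h') (at (cmap cT ?p ?p))"
    using f_smooth smooth_near_imp_differentiable by (auto simp: smooth_fun_def frechet_derivative_works)
  have 1: "(fst has_derivative fst) (at z)" "(snd has_derivative snd) (at z)"
    for z :: "'x::real_normed_vector \<times> 'y::real_normed_vector"
    using has_derivative_fst[OF has_derivative_ident] has_derivative_snd[OF has_derivative_ident] by auto
  have xi: "fst ?xi = cmap cT ?p ?p" "snd ?xi = cmap cS ?q ?q" by (simp_all add: cmap_prod_atlas)
  have hp: "?h (fst ?xi) = f ?p" by (simp add: xi cinv_cmap[OF cT cdom_self[OF cT]])
  have sp: "metric_rep cS gS ?q (snd ?xi) s t = gS ?q s t" for s t
    by (simp add: xi metric_rep_def cinv_cmap[OF cS cdom_self[OF cS]] tcoord_change_self[OF cS cdom_self[OF cS]])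
  have dT: "((\<lambda>z. metric_rep cT gT ?p (fst z) (fst u) (fst v)) has_derivative
     (\<lambda>w. gT ?p (levi_civita cT gT ?p (fst w) (fst u)) (fst v) + gT ?p (fst u) (levi_civita cT gT ?p (fst w) (fst v)))) (at ?xi)"
    using mT.lc_levi_civita[of ?p] unfolding lc_at_def
    by (intro has_derivative_compose[OF 1(1)]) (simp add: xi)
  have dS: "((\<lambda>z. metric_rep cS gS ?q (snd z) (snd u) (snd v)) has_derivative
     (\<lambda>w. gS ?q (levi_civita cS gS ?q (snd w) (snd u)) (snd v) + gS ?q (snd u) (levi_civita cS gS ?q (snd w) (snd v)))) (at ?xi)"
    using mS.lc_levi_civita[of ?q] unfolding lc_at_def
    by (intro has_derivative_compose[OF 1(2)]) (simp add: xi)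
  have dh: "((\<lambda>z. ?h (fst z)) has_derivative (\<lambda>w. ?h' (fst w))) (at ?xi)"
    by (rule has_derivative_compose[OF 1(1)]) (simp add: xi h del: o_apply)
  note D = has_derivative_add[OF dT has_derivative_mult[OF has_derivative_mult[OF dh dh] dS]]
  have "\<forall>\<^sub>F z in nhds ?xi. metric_rep cM gM x z u v = metric_rep cT gT ?p (fst z) (fst u) (fst v)
     + ?h (fst z) * ?h (fst z) * metric_rep cS gS ?q (snd z) (snd u) (snd v)"
    using eventually_chart[OF cP cdom_self[OF cP, of x], of "\<lambda>_. True", simplified]
  proof eventually_elim
    case (elim z)
    define y where "y = cinv cM x z"
    have y: "y \<in> cdom cM x" "fst y \<in> cdom cT ?p" "snd y \<in> cdom cS ?q" and z: "z = cmap cM x y"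
      using elim by (auto simp: cdom_prod_atlas y_def)
    have "cinv cM x z = y" by (simp add: y_def)
    moreover have "cinv cT ?p (fst z) = fst y" "cinv cS ?q (snd z) = snd y"
      using y by (simp_all add: z cmap_prod_atlas cinv_cmap[OF cT] cinv_cmap[OF cS])
    ultimately show ?case
      using coord_field_prod[OF y(1), of "fst u" "snd u"] coord_field_prod[OF y(1), of "fst v" "snd v"]
      by (simp add: metric_rep_def Let_def gM_eq warped_metric_def coord_field_def power2_eq_square)
  qed
  from has_derivative_unique[OF has_derivative_cong_nhds[OF D this] has_derivative_induced_metric_rep]
  have "g (F x) (B x w u) (dF x v) + g (F x) (dF x u) (B x w v) =
    (gT ?p (levi_civita cT gT ?p (fst w) (fst u)) (fst v) + gT ?p (fst u) (levi_civita cT gT ?p (fst w) (fst v)))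
    + (?h (fst ?xi) * ?h (fst ?xi) * (gS ?q (levi_civita cS gS ?q (snd w) (snd u)) (snd v) + gS ?q (snd u) (levi_civita cS gS ?q (snd w) (snd v)))
    + (?h (fst ?xi) * ?h' (fst w) + ?h' (fst w) * ?h (fst ?xi)) * metric_rep cS gS ?q (snd ?xi) (snd u) (snd v))"
    by (simp only: fun_eq_iff)
  then show ?thesis
    unfolding hp sp dlnf_def using f_pos[of ?p] by (simp add: power2_eq_square field_simps)
qed

section \<open>Mixed terms of the warped product connection\<close>

lemmas T_zero = bilinear_lzero[OF mT.bil] bilinear_rzero[OF mT.bil]
  bilinear_lzero[OF lc_at_def[THEN iffD1, THEN conjunct1, OF mT.lc_levi_civita]]
  bilinear_rzero[OF lc_at_def[THEN iffD1, THEN conjunct1, OF mT.lc_levi_civita]]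
lemmas S_zero = bilinear_lzero[OF mS.bil] bilinear_rzero[OF mS.bil]
  bilinear_lzero[OF lc_at_def[THEN iffD1, THEN conjunct1, OF mS.lc_levi_civita]]
  bilinear_rzero[OF lc_at_def[THEN iffD1, THEN conjunct1, OF mS.lc_levi_civita]]

lemma g_commute: "g q u v = g q v u" by (rule inner_product_commute[OF ip])

lemma warped_fst_snd_snd:
  "g (F x) (B x (a, 0) (0, z)) (dF x (0, w)) + g (F x) (dF x (0, z)) (B x (a, 0) (0, w))
    = 2 * dlnf x a * g (F x) (dF x (0, z)) (dF x (0, w))"
  using warped_derivative[of x "(a, 0)" "(0, z)" "(0, w)"] by (simp add: T_zero S_zero gM_apply)

lemma warped_snd_fst_snd:
  "g (F x) (B x (0, z) (a, 0)) (dF x (0, w)) = - g (F x) (dF x (a, 0)) (B x (0, z) (0, w))"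
  using warped_derivative[of x "(0, z)" "(a, 0)" "(0, w)"] by (simp add: T_zero S_zero)

text \<open>By \<open>warped_snd_fst_snd\<close> and symmetry of \<open>B\<close>, the left side is
  symmetric in z and w. So it is half of the metric derivative along the first factor.\<close>

lemma B_fst_snd_snd:
  "g (F x) (B x (a, 0) (0, z)) (dF x (0, w)) = dlnf x a * g (F x) (dF x (0, z)) (dF x (0, w))"
proof -
  have "g (F x) (B x (a, 0) (0, z)) (dF x (0, w)) = g (F x) (B x (a, 0) (0, w)) (dF x (0, z))"
    using warped_snd_fst_snd[of x z a w] warped_snd_fst_snd[of x w a z]
      B_commute[of x "(0, z)" "(0, w)"] B_commute[of x "(a, 0)"] by simp
  then show ?thesis
    using warped_fst_snd_snd[of x a z w] g_commute[of "F x" "dF x (0, z)" "B x (a, 0) (0, w)"] by simp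
qed

text \<open>The expression is symmetric in a and b since it equals minus the pairing of z with
  \<open>B x (a, 0) (b, 0)\<close>. It is also antisymmetric, because the metric of the first factor
  is constant along the second.\<close>

lemma B_fst_snd_fst: "g (F x) (B x (a, 0) (0, z)) (dF x (b, 0)) = 0"
proof -
  have 1: "g (F x) (B x (0, z) (a, 0)) (dF x (b, 0)) + g (F x) (dF x (a, 0)) (B x (0, z) (b, 0)) = 0"
    using warped_derivative[of x "(0, z)" "(a, 0)" "(b, 0)"] by (simp add: T_zero S_zero dlnf_def)
  have 2: "g (F x) (B x (a, 0) (0, z)) (dF x (b, 0)) + g (F x) (dF x (0, z)) (B x (a, 0) (b, 0)) = 0" for a b
    using warped_derivative[of x "(a, 0)" "(0, z)" "(b, 0)"] by (simp add: T_zero S_zero)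
  show ?thesis
    using 1 2[of a b] 2[of b a] B_commute[of x "(a, 0)" "(b, 0)"] B_commute[of x "(0, z)"]
      g_commute[of "F x" "dF x (a, 0)" "B x (0, z) (b, 0)"] by simp
qed

lemma levi_civita_fst_snd: "levi_civita cM gM x (a, 0) (0, z) = dlnf x a *\<^sub>R (0, z)"
proof (rule inner_product_eqI[OF inner_product_induced[of x]])
  fix w :: "'ea \<times> 'eb"
  have w: "dF x w = dF x (fst w, 0) + dF x (0, snd w)"
    by (simp flip: linear_add[OF linear_mdiff])
  show "gM x (levi_civita cM gM x (a, 0) (0, z)) w = gM x (dlnf x a *\<^sub>R (0, z)) w"
    unfolding induced_metric_def levi_civita_induced
    by (simp add: w bilinear_radd[OF bil] B_fst_snd_snd B_fst_snd_fst linear_cmul[OF linear_mdiff]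
       bilinear_lmul[OF bil] gM_mixed del: scaleR_Pair)
qed

lemma eta_snd: "\<eta> (F x) (dF x (0, z)) = 0"
  using xi_tangent[of x] gM_mixed(2)[of x z] g_xi by metis

lemma phi_fst_snd: "g (F x) (\<phi> (F x) (dF x (a, 0))) (dF x (0, z)) = 0"
  using phi_invariant[of x a] gM_mixed(1) by metis

lemma phi_snd_fst: "g (F x) (\<phi> (F x) (dF x (0, z))) (dF x (a, 0)) = 0"
  using phi_fst_snd phi_skew g_commute by (metis neg_equal_0_iff_equal)

lemma phi_skew': "g q (\<phi> q u) v = - g q (\<phi> q v) u"
  using phi_skew g_commute by metis

text \<open>Obtained by differentiating g(\<phi> X, W) = 0 along the second factor. The Kenmotsu
  identity yields the \<eta> term; the derivative falling on W yields the \<open>dlnf\<close> term,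
  as \<phi> X stays in the first factor.\<close>

lemma B_fst_snd_phi:
  assumes b: "\<phi> (F x) (dF x (a, 0)) = dF x (b, 0)"
  shows "g (F x) (B x (a, 0) (0, z)) (\<phi> (F x) (dF x (0, w))) =
    - dlnf x b * g (F x) (dF x (0, z)) (dF x (0, w))
    - \<eta> (F x) (dF x (a, 0)) * g (F x) (\<phi> (F x) (dF x (0, z))) (dF x (0, w))"
proof -
  note V = diff_field_tangent[OF diff_coord_field[of x "(a, 0)"]]
    and W = diff_field_tangent[OF diff_coord_field[of x "(0, w)"]]
  note L = D_leibniz[OF diff_field_phi[OF V] W]
  have "\<forall>\<^sub>F z in nhds (cmap cM x x). g (F (cinv cM x z)) (\<phi> (F (cinv cM x z)) (dF (cinv cM x z) (coord_field cM x (a, 0) (cinv cM x z))))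
     (dF (cinv cM x z) (coord_field cM x (0, w) (cinv cM x z))) = 0"
    \<comment> \<open>In a product chart the constant extensions remain in their own factors, so
      orthogonality holds on a neighbourhood.\<close>
    by (rule eventually_rep) (simp add: coord_field_prod coord_field_zero phi_fst_snd)
  then have "\<forall>\<^sub>F z in nhds (cmap cM x x). 0 = ((\<lambda>y. g (F y) (\<phi> (F y) (dF y (coord_field cM x (a, 0) y)))
     (dF y (coord_field cM x (0, w) y))) \<circ> cinv cM x) z"
    by eventually_elim simp
  from fun_cong[OF has_derivative_unique[OF has_derivative_cong_nhds[OF L this] has_derivative_const], of "(0, z)"]
  have "g (F x) (\<phi> (F x) (B x (0, z) (a, 0)) + g (F x) (\<phi> (F x) (dF x (0, z))) (dF x (a, 0)) *\<^sub>R \<xi> (F x)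
      - \<eta> (F x) (dF x (a, 0)) *\<^sub>R \<phi> (F x) (dF x (0, z))) (dF x (0, w))
    + g (F x) (\<phi> (F x) (dF x (a, 0))) (B x (0, z) (0, w)) = 0"
    unfolding D_phi[OF V] D_coord_field coord_field_self[OF cP] .
  moreover have "g (F x) (dF x (b, 0)) (B x (0, z) (0, w)) = - dlnf x b * g (F x) (dF x (0, z)) (dF x (0, w))"
    using warped_snd_fst_snd[of x z b w] B_fst_snd_snd[of x b z w] B_commute[of x "(0, z)" "(b, 0)"] by simp
  ultimately show ?thesis
    using phi_skew[of "F x" "B x (0, z) (a, 0)"] B_commute[of x "(0, z)" "(a, 0)"]
    by (simp add: phi_snd_fst bilinear_lsub[OF bil] bilinear_lmul[OF bil] b)
qed

text \<open>\<phi> is skew and preserves the first factor, hence T z is orthogonal to that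
  factor.\<close>

lemma fst_T_snd: "T x (0, z) = (0, snd (T x (0, z)))"
proof -
  let ?t = "T x (0, z)"
  have "g (F x) (dF x ?t) (dF x (fst ?t, 0)) = 0"
    by (simp add: inner_tang phi_snd_fst)
  then have "gT (fst x) (fst ?t) (fst ?t) = 0" by (simp add: gM_apply S_zero)
  then have "fst ?t = 0" using inner_product_pos[OF mT.ip] by (metis less_irrefl)
  then show ?thesis by (simp add: prod_eq_iff)
qed

text \<open>Along the first factor the metric on the second one is scaled by the rate \<open>2 dlnf\<close> and the
  fundamental 2-form by the rate \<open>2 \<eta>\<close>. The slant condition bounds the square of the latter by
  the square of the former, with equality at \<open>x\<close>, so the two rates agree.\<close>
lemma dlnf_eq_eta:
  assumes slant: "\<And>y z. g (F y) (dF y (T y (0, z))) (dF y (T y (0, z))) = C * g (F y) (dF y (0, z)) (dF y (0, z))"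
    and C: "C > 0"
  shows "dlnf x a = \<eta> (F x) (dF x (a, 0))"
proof -
  obtain z :: 'eb where z: "z \<noteq> 0" using nonzero_Basis SOME_Basis by blast
  \<comment> \<open>The vector for which Cauchy-Schwarz is an equality at x. Only its value at x is
    T z; nearby it has constant components.\<close>
  define s where "s = snd (T x (0, z))"
  have s: "T x (0, z) = (0, s)" using fst_T_snd by (simp add: s_def)
  let ?c = "\<lambda>z. coord_field cM x (0, z)"
  let ?A = "\<lambda>z w. (\<lambda>y. g (F y) (dF y (?c z y)) (dF y (?c w y))) \<circ> cinv cM x"
  let ?O = "(\<lambda>y. g (F y) (\<phi> (F y) (dF y (?c z y))) (dF y (?c s y))) \<circ> cinv cM x"
  let ?x = "cmap cM x x"
  note W = diff_field_tangent[OF diff_coord_field]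
  have LA: "(?A z w has_derivative (\<lambda>u. g (F x) (B x u (0, z)) (dF x (0, w)) + g (F x) (dF x (0, z)) (B x u (0, w)))) (at ?x)" for z w
    using D_leibniz[OF W W] by (simp only: D_coord_field coord_field_self[OF cP])
  obtain b where b: "\<phi> (F x) (dF x (a, 0)) = dF x (b, 0)" using phi_invariant by blast
  define O' where "O' = (\<lambda>u. g (F x) (D (\<lambda>y. \<phi> (F y) (dF y (?c z y))) x u) (dF x (0, s))
     + g (F x) (\<phi> (F x) (dF x (0, z))) (B x u (0, s)))"
  have LO: "(?O has_derivative O') (at ?x)"
    unfolding O'_def using D_leibniz[OF diff_field_phi[OF W] W] by (simp only: D_coord_field coord_field_self[OF cP])
  \<comment> \<open>The \<open>dlnf x b\<close> terms cancel because they multiply the symmetric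
    metric; the \<eta> terms double because they multiply the skew 2-form.\<close>
  have O'_a: "O' (a, 0) = 2 * \<eta> (F x) (dF x (a, 0)) * g (F x) (\<phi> (F x) (dF x (0, z))) (dF x (0, s))"
  proof -
    have "O' (a, 0) = g (F x) (\<phi> (F x) (B x (a, 0) (0, z))) (dF x (0, s))
       + g (F x) (\<phi> (F x) (dF x (0, z))) (B x (a, 0) (0, s))"
      unfolding O'_def D_phi[OF W] D_coord_field coord_field_self[OF cP]
      by (simp add: phi_fst_snd eta_snd)
    also have "\<dots> = - g (F x) (B x (a, 0) (0, z)) (\<phi> (F x) (dF x (0, s)))
       + g (F x) (B x (a, 0) (0, s)) (\<phi> (F x) (dF x (0, z)))"
      by (simp add: phi_skew g_commute)
    also have "\<dots> = \<eta> (F x) (dF x (a, 0)) * g (F x) (\<phi> (F x) (dF x (0, z))) (dF x (0, s))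
      - \<eta> (F x) (dF x (a, 0)) * g (F x) (\<phi> (F x) (dF x (0, s))) (dF x (0, z))"
      unfolding B_fst_snd_phi[OF b] g_commute[of "F x" "dF x (0, s)" "dF x (0, z)"] by simp
    finally show ?thesis
      unfolding phi_skew'[of "F x" "dF x (0, s)" "dF x (0, z)"] by simp
  qed
  define \<alpha> where "\<alpha> = g (F x) (dF x (0, z)) (dF x (0, z))"
  have \<alpha>: "\<alpha> > 0"
    unfolding \<alpha>_def using inner_product_pos[OF inner_product_induced, of "(0, z)" x] z
    by (simp add: induced_metric_def zero_prod_def)
  have ss: "g (F x) (dF x (0, s)) (dF x (0, s)) = C * \<alpha>"
    using slant[of x z] by (simp add: s \<alpha>_def)
  have Oz: "g (F x) (\<phi> (F x) (dF x (0, z))) (dF x (0, s)) = C * \<alpha>"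
    using inner_tang[of x "\<phi> (F x) (dF x (0, z))" "(0, s)"] ss s by simp
  have at_x: "?A z w ?x = g (F x) (dF x (0, z)) (dF x (0, w))" "?O ?x = C * \<alpha>" for z w
    by (simp_all add: cinv_cmap[OF cP cdom_self[OF cP]] coord_field_self[OF cP] Oz)
  \<comment> \<open>The function to be minimised at x is C |z|^2 |s|^2 minus the square of the
    2-form on z and s.\<close>
  note LP = has_derivative_diff[OF has_derivative_mult_right[OF has_derivative_mult[OF LA[of z z] LA[of s s]], of C]
    has_derivative_mult[OF LO LO]]
  have "\<forall>\<^sub>F y in nhds ?x. C * (g (F (cinv cM x y)) (dF (cinv cM x y) (?c z (cinv cM x y))) (dF (cinv cM x y) (?c z (cinv cM x y)))
      * g (F (cinv cM x y)) (dF (cinv cM x y) (?c s (cinv cM x y))) (dF (cinv cM x y) (?c s (cinv cM x y))))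
      - g (F (cinv cM x y)) (\<phi> (F (cinv cM x y)) (dF (cinv cM x y) (?c z (cinv cM x y)))) (dF (cinv cM x y) (?c s (cinv cM x y)))
      * g (F (cinv cM x y)) (\<phi> (F (cinv cM x y)) (dF (cinv cM x y) (?c z (cinv cM x y)))) (dF (cinv cM x y) (?c s (cinv cM x y))) \<ge> 0"
  proof (rule eventually_rep)
    fix y assume y: "y \<in> cdom cM x"
    obtain z' s' where c: "?c z y = (0, z')" "?c s y = (0, s')"
      using y by (simp add: coord_field_prod coord_field_zero)
    have "(g (F y) (dF y (T y (0, z'))) (dF y (0, s')))\<^sup>2
      \<le> g (F y) (dF y (T y (0, z'))) (dF y (T y (0, z'))) * g (F y) (dF y (0, s')) (dF y (0, s'))"
      using inner_product_cauchy_schwarz[OF ip] by blast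
    then have "(g (F y) (\<phi> (F y) (dF y (0, z'))) (dF y (0, s')))\<^sup>2
      \<le> C * g (F y) (dF y (0, z')) (dF y (0, z')) * g (F y) (dF y (0, s')) (dF y (0, s'))"
      unfolding slant[of y z'] inner_tang[of y _ "(0, s')"] .
    then show "0 \<le> C * (g (F y) (dF y (?c z y)) (dF y (?c z y)) * g (F y) (dF y (?c s y)) (dF y (?c s y)))
      - g (F y) (\<phi> (F y) (dF y (?c z y))) (dF y (?c s y)) * g (F y) (\<phi> (F y) (dF y (?c z y))) (dF y (?c s y))"
      unfolding c by (simp add: power2_eq_square mult.assoc)
  qed
  then have "\<forall>\<^sub>F y in at ?x. 0 \<le> C * (?A z z y * ?A s s y) - ?O y * ?O y"
    by (auto simp: eventually_at_filter elim: eventually_mono)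
  moreover have "C * (?A z z ?x * ?A s s ?x) - ?O ?x * ?O ?x = 0"
    unfolding at_x ss \<alpha>_def[symmetric] by simp
  ultimately have min: "\<forall>\<^sub>F y in at ?x. C * (?A z z ?x * ?A s s ?x) - ?O ?x * ?O ?x
      \<le> C * (?A z z y * ?A s s y) - ?O y * ?O y"
    by (simp only:)
  \<comment> \<open>At x both |s|^2 and the 2-form equal C \<alpha>, so the critical point equation
    compares the two rates with the common factor 4 (C \<alpha>)^2.\<close>
  from fun_cong[OF has_derivative_local_min[OF LP min], of "(a, 0)"]
  have "C * (\<alpha> * (2 * dlnf x a * (C * \<alpha>)) + 2 * dlnf x a * \<alpha> * (C * \<alpha>))
    - (C * \<alpha> * (2 * \<eta> (F x) (dF x (a, 0)) * (C * \<alpha>)) + 2 * \<eta> (F x) (dF x (a, 0)) * (C * \<alpha>) * (C * \<alpha>)) = 0"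
    unfolding at_x warped_fst_snd_snd O'_a Oz ss \<alpha>_def[symmetric] by simp
  then have "4 * (C * \<alpha>)\<^sup>2 * (dlnf x a - \<eta> (F x) (dF x (a, 0))) = 0"
    by (simp add: power2_eq_square algebra_simps)
  then show ?thesis using C \<alpha> by simp
qed

text \<open>Once l = \<eta>, the three contributions to the pairing with N W vanish one by one, with
  no cancellation between them.\<close>

lemma covd_N_in_normal_complement:
  assumes slant: "\<And>y z. g (F y) (dF y (T y (0, z))) (dF y (T y (0, z))) = C * g (F y) (dF y (0, z)) (dF y (0, z))"
    and C: "C > 0" and Z: "diff_tangent_field Z x" "Z x \<in> T_snd x" and X: "X x \<in> T_fst x"
  shows "covd_N cM c \<phi> g F X Z x \<in> normal_complement_N cM c \<phi> g F T_snd x"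
proof -
  obtain a z where a: "X x = (a, 0)" and z: "Z x = (0, z)"
    using Z(2) X by (auto simp: T_fst_def T_snd_def)
  obtain b where b: "\<phi> (F x) (dF x (a, 0)) = dF x (b, 0)" using phi_invariant by blast
  note rate = dlnf_eq_eta[OF slant C]
  \<comment> \<open>The rate equality is applied to \<phi> X, which is again tangent to the first
    factor.\<close>
  have rate_b: "dlnf x b = 0" unfolding rate b[symmetric] by (rule eta_phi)
  let ?t = "snd (T x (0, z))"
  define v where "v = \<phi> (F x) (B x (a, 0) (0, z) - dF x (dlnf x a *\<^sub>R (0, z))) - B x (a, 0) (0, ?t)"
  have covd: "covd_N cM c \<phi> g F X Z x = nor x v"
    unfolding covd_N_eq[of Z, OF Z(1)] a z v_def
    using fst_T_snd[of x z] by (simp add: phi_fst_snd eta_snd levi_civita_fst_snd del: scaleR_Pair)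
  have "g (F x) (nor x v) (N_op cM c \<phi> g F x (0, w)) = 0" for w
  proof -
    let ?N = "N_op cM c \<phi> g F x (0, w)"
    define r where "r = snd (T x (0, w))"
    have r: "T x (0, w) = (0, r)" using fst_T_snd by (simp add: r_def)
    have N: "?N = \<phi> (F x) (dF x (0, w)) - dF x (0, r)" by (simp add: N_op_eq r)
    have "g (F x) (dF x u) ?N = 0" for u
      using normal_part_normal g_commute by (simp add: N_op_def)
    then have "g (F x) (nor x v) ?N = g (F x) v ?N"
      unfolding normal_part_eq[of x v] by (simp add: bilinear_lsub[OF bil])
    also have "\<dots> = 0"
    proof -
      define n where "n = B x (a, 0) (0, z) - dF x (dlnf x a *\<^sub>R (0, z))"
      have dlin: "dF x (dlnf x a *\<^sub>R (0, z)) = dlnf x a *\<^sub>R dF x (0, z)"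
        by (rule linear_cmul[OF linear_mdiff])
      have n1: "g (F x) (\<phi> (F x) n) (\<phi> (F x) (dF x (0, w))) = 0"
        unfolding g_phi_phi eta_snd n_def dlin
        by (simp add: bilinear_lsub[OF bil] bilinear_lmul[OF bil] B_fst_snd_snd)
      \<comment> \<open>Moving \<phi> across leaves (\<eta>(X) - l(X)) g(\<phi> z, r), which the
        rate equality kills.\<close>
      have n2: "g (F x) (\<phi> (F x) n) (dF x (0, r)) = 0"
        unfolding phi_skew n_def dlin
        by (simp add: bilinear_lsub[OF bil] bilinear_lmul[OF bil] B_fst_snd_phi[OF b] rate_b rate[of x a]
            phi_skew[of "F x" "dF x (0, z)"])
      have Om: "g (F x) (\<phi> (F x) (dF x (0, ?t))) (dF x (0, w)) = - g (F x) (dF x (0, ?t)) (dF x (0, r))"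
        using inner_tang[of x "\<phi> (F x) (dF x (0, w))" "(0, ?t)"] r
          phi_skew'[of "F x" "dF x (0, ?t)" "dF x (0, w)"] g_commute[of "F x" "dF x (0, r)" "dF x (0, ?t)"]
        by simp
      have n3: "g (F x) (B x (a, 0) (0, ?t)) (\<phi> (F x) (dF x (0, w)) - dF x (0, r)) = 0"
        by (simp add: bilinear_rsub[OF bil] B_fst_snd_phi[OF b] rate_b Om B_fst_snd_snd rate[of x a])
      show ?thesis
        unfolding v_def N n_def[symmetric] using n1 n2 n3
        by (simp add: bilinear_lsub[OF bil] bilinear_rsub[OF bil])
    qed
    finally show ?thesis .
  qed
  then show ?thesis
    unfolding covd normal_complement_N_def using normal_part_in_nspace by (auto simp: T_snd_def)
qed

section \<open>From the slant angle to the ratio of lengths\<close>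

text \<open>T z already lies in the second factor, so projecting \<phi> z to that factor or to the
  whole tangent space gives the same vector. As \<eta>(z) = 0, \<phi> keeps the length of z. The
  ratio lies in [0, 1], so \<open>arccos\<close> can be inverted, and its only value with cosine 0
  is pi / 2.\<close>

lemma slant_angle:
  assumes z: "z \<noteq> 0" and angle: "angle_with_subspace (g (F x)) (\<phi> (F x) (dF x (0, z))) (dF x ` T_snd x) = \<theta>"
  shows "g (F x) (dF x (T x (0, z))) (dF x (T x (0, z))) = (cos \<theta>)\<^sup>2 * g (F x) (dF x (0, z)) (dF x (0, z))"
    and "cos \<theta> = 0 \<Longrightarrow> \<theta> = pi / 2"
proof -
  let ?v = "\<phi> (F x) (dF x (0, z))" and ?t = "T x (0, z)"
  have nonneg: "g (F x) u u \<ge> 0" for u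
    using inner_product_pos[OF ip, of u] by (cases "u = 0") (auto simp: bilinear_lzero[OF bil] less_imp_le)
  have "linear (\<lambda>s::'eb. (0::'ea, s))" by (rule linearI) simp_all
  from linear_compose[OF this linear_mdiff] have L: "linear (\<lambda>s. dF x (0, s))" by (simp add: o_def)
  have inj: "inj (\<lambda>s. dF x (0, s))" using inj_mdiff[of x] by (auto simp: inj_def)
  have range: "dF x ` T_snd x = range (\<lambda>s. dF x (0, s))" by (auto simp: T_snd_def)
  have "orth_proj (g (F x)) (range (\<lambda>s. dF x (0, s))) ?v = dF x (0, snd ?t)"
    by (rule orth_proj_eqI[OF ip L inj])
       (simp only: fst_T_snd[symmetric] bilinear_lsub[OF bil] inner_tang diff_self)
  then have proj: "orth_proj (g (F x)) (dF x ` T_snd x) ?v = dF x ?t"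
    unfolding range by (simp only: fst_T_snd[symmetric])
  have vv: "g (F x) ?v ?v = g (F x) (dF x (0, z)) (dF x (0, z))" by (simp add: g_phi_phi eta_snd)
  have pos: "g (F x) (dF x (0, z)) (dF x (0, z)) > 0"
    using inner_product_pos[OF inner_product_induced, of "(0, z)" x] z
    by (simp add: induced_metric_def zero_prod_def)
  define r where "r = sqrt (g (F x) (dF x ?t) (dF x ?t)) / sqrt (g (F x) (dF x (0, z)) (dF x (0, z)))"
  have theta: "\<theta> = arccos r"
    using angle by (simp add: angle_with_subspace_def proj vv r_def Let_def)
  have "g (F x) (dF x ?t) (dF x ?t) \<le> g (F x) ?v ?v"
    using nonneg[of "?v - dF x ?t"] inner_tang[of x ?v ?t] g_commute[of "F x" "dF x ?t" ?v]
    by (simp add: bilinear_lsub[OF bil] bilinear_rsub[OF bil])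
  then have "0 \<le> r" "r \<le> 1" using pos nonneg by (simp_all add: r_def vv)
  then have cos_theta: "cos \<theta> = r" unfolding theta by (intro cos_arccos) auto
  show "g (F x) (dF x ?t) (dF x ?t) = (cos \<theta>)\<^sup>2 * g (F x) (dF x (0, z)) (dF x (0, z))"
    unfolding cos_theta r_def using pos nonneg by (simp add: power_divide)
  show "cos \<theta> = 0 \<Longrightarrow> \<theta> = pi / 2" using cos_theta theta arccos_0 by metis
qed

end

theorem theorem4p1:
  fixes c :: "('m::{t2_space,second_countable_topology}, 'e::euclidean_space) pointed_atlas"
    and \<phi> :: "'m \<Rightarrow> 'e \<Rightarrow> 'e" and \<xi> :: "'m \<Rightarrow> 'e" and \<eta> :: "'m \<Rightarrow> 'e \<Rightarrow> real"
    and g :: "'m \<Rightarrow> 'e \<Rightarrow> 'e \<Rightarrow> real"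
    and cT :: "('a::{t2_space,second_countable_topology}, 'ea::euclidean_space) pointed_atlas"
    and gT :: "'a \<Rightarrow> 'ea \<Rightarrow> 'ea \<Rightarrow> real"
    and cS :: "('b::{t2_space,second_countable_topology}, 'eb::euclidean_space) pointed_atlas"
    and gS :: "'b \<Rightarrow> 'eb \<Rightarrow> 'eb \<Rightarrow> real"
    and f :: "'a \<Rightarrow> real" and F :: "'a \<times> 'b \<Rightarrow> 'm"
    and D1 D2 :: "'a \<times> 'b \<Rightarrow> 'e set" and \<theta> :: real
    and U :: "('a \<times> 'b) set" and X Z :: "'a \<times> 'b \<Rightarrow> 'ea \<times> 'eb"
  defines "cM \<equiv> prod_atlas cT cS"
  assumes kenmotsu: "kenmotsu_manifold c \<phi> \<xi> \<eta> g"
    and warped: "warped_product_submanifold cT gT cS gS f c g F"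
    and semi_slant: "semi_slant_submanifold cM c \<phi> \<xi> g F D1 D2 \<theta>"
    and TN_T: "\<And>x. mdiff cM c F x ` T_fst x = {a + r *\<^sub>R \<xi> (F x) | a r. a \<in> D1 x}"
    and TN_S: "\<And>x. mdiff cM c F x ` T_snd x = D2 x"
    and xi_tangent: "\<And>x. \<xi> (F x) \<in> mdiff cM c F x ` T_fst x"
    and N_T: "\<And>q. invariant_submanifold cT c \<phi> (\<lambda>p. F (p, q))"
    and N_S: "\<And>p. proper_slant_submanifold cS c \<phi> \<xi> g (\<lambda>q. F (p, q)) \<theta>"
    and U: "open U"
    and X: "\<And>x. x \<in> U \<Longrightarrow> smooth_field_at cM X x" "\<And>x. x \<in> U \<Longrightarrow> X x \<in> T_fst x"
    and Z: "\<And>x. x \<in> U \<Longrightarrow> smooth_field_at cM Z x" "\<And>x. x \<in> U \<Longrightarrow> Z x \<in> T_snd x"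
  shows "\<forall>x\<in>U. covd_N cM c \<phi> g F X Z x \<in> normal_complement_N cM c \<phi> g F T_snd x"
proof -
  \<comment> \<open>The locale writes the product atlas out through its own abbreviation; unfolding
    makes the hypotheses match it.\<close>
  note semi_slant = semi_slant[unfolded cM_def] and TN_T = TN_T[unfolded cM_def]
    and TN_S = TN_S[unfolded cM_def] and xi_tangent = xi_tangent[unfolded cM_def]
    and Z = Z[unfolded cM_def]
  let ?M = "prod_atlas cT cS"
  let ?dF = "mdiff ?M c F"
  have contact: "almost_contact_metric_structure c \<phi> \<xi> \<eta> g"
    using kenmotsu by (simp add: kenmotsu_manifold_def)
  then have c: "smooth_atlas c" and g: "riemannian_metric c g" and phi: "\<And>q. linear (\<phi> q)"
    and phi_xi: "\<And>q. \<phi> q (\<xi> q) = 0"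
    by (auto simp: almost_contact_metric_structure_def smooth_endomorphism_field_def)
  have cT: "smooth_atlas cT" "riemannian_metric cT gT" and cS: "smooth_atlas cS" "riemannian_metric cS gS"
    and f: "smooth_fun cT f" "\<And>p. f p > 0" and sub: "submanifold ?M c F"
    and metric: "induced_metric ?M c g F = warped_metric gT f gS"
    using warped by (auto simp: warped_product_submanifold_def)
  have sub: "kenmotsu_submanifold ?M c F g \<phi> \<xi> \<eta>"
  proof -
    have M: "smooth_atlas ?M" and inj: "inj (?dF x)" and F: "continuous_on UNIV F"
      and smooth: "smooth_near (cmap c (F x) \<circ> F \<circ> cinv ?M x) (cmap ?M x x)" for x
      using sub unfolding submanifold_def smooth_map_def by blast+
    interpret chart_map ?M c F
      by unfold_locales (rule M c F smooth_near_imp_differentiable[OF smooth])+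
    interpret metric_atlas c g by (rule riemannian_metric_imp_metric_atlas[OF c g])
    show ?thesis
      by unfold_locales (simp_all add: smooth inj kenmotsu map_rep_def)
  qed
  have xi: "\<exists>a. \<xi> (F x) = ?dF x (a, 0)" for x
    using xi_tangent[of x] by (auto simp: T_fst_def)
  have invariant: "\<exists>b. \<phi> (F x) (?dF x (a, 0)) = ?dF x (b, 0)" for x a
  proof -
    have "?dF x (a, 0) \<in> ?dF x ` T_fst x" by (auto simp: T_fst_def)
    \<comment> \<open>\<phi> preserves D1 and annihilates \<xi>, so the image returns to the first
      factor with \<xi> coefficient 0.\<close>
    then obtain d r where d: "d \<in> D1 x" "?dF x (a, 0) = d + r *\<^sub>R \<xi> (F x)"
      unfolding TN_T by blast
    have "\<phi> (F x) ` D1 x = D1 x" using semi_slant unfolding semi_slant_submanifold_def by blast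
    then have "\<phi> (F x) d \<in> D1 x" using d(1) by blast
    moreover have "\<phi> (F x) (?dF x (a, 0)) = \<phi> (F x) d + 0 *\<^sub>R \<xi> (F x)"
      by (simp add: d(2) linear_add[OF phi] linear_cmul[OF phi] phi_xi)
    ultimately have "\<phi> (F x) (?dF x (a, 0)) \<in> ?dF x ` T_fst x"
      unfolding TN_T by blast
    then show ?thesis by (auto simp: T_fst_def)
  qed
  interpret warped_kenmotsu_submanifold cT cS c F g \<phi> \<xi> \<eta> gT gS f
    unfolding warped_kenmotsu_submanifold_def warped_kenmotsu_submanifold_axioms_def
    by (intro conjI allI sub cT cS f metric xi invariant)
  have angle: "angle_with_subspace (g (F x)) (\<phi> (F x) (dF x (0, z))) (dF x ` T_snd x) = \<theta>"
    if "z \<noteq> 0" for x z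
  proof -
    have "dF x (0, z) \<in> D2 x" using TN_S[of x] by (auto simp: T_snd_def)
    moreover have "dF x (0, z) \<noteq> 0"
      using that inj_mdiff[of x] linear_0[OF linear_mdiff[of x]] by (metis injD prod.inject zero_prod_def)
    ultimately show ?thesis
      unfolding TN_S using semi_slant unfolding semi_slant_submanifold_def by blast
  qed
  have slant: "g (F y) (dF y (T y (0, z))) (dF y (T y (0, z))) = (cos \<theta>)\<^sup>2 * g (F y) (dF y (0, z)) (dF y (0, z))" for y z
  \<comment> \<open>The angle is constrained only for nonzero vectors; at zero both sides
    vanish.\<close>
  proof (cases "z = 0")
    case True
    have "T y 0 = 0"
      by (simp add: linear_0[OF linear_mdiff] linear_0[OF phi] linear_0[OF linear_tang])
    then show ?thesis using True
      by (simp add: zero_prod_def[symmetric] linear_0[OF linear_mdiff] bilinear_lzero[OF bil])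
  next
    case False
    show ?thesis by (rule slant_angle(1)[OF False angle[OF False]])
  qed
  \<comment> \<open>A witness is needed to know that \<theta> is a value of \<open>arccos\<close>;
    then \<theta> different from pi / 2 forces a nonzero cosine.\<close>
  obtain z :: 'eb where z: "z \<noteq> 0" using nonzero_Basis SOME_Basis by blast
  have "\<theta> \<noteq> pi / 2"
    using N_S by (simp add: proper_slant_submanifold_def)
  then have "cos \<theta> \<noteq> 0"
    using slant_angle(2)[OF z angle[OF z]] by blast
  then have C: "(cos \<theta>)\<^sup>2 > 0" by simp
  show ?thesis
    unfolding cM_def
  proof
    fix x assume x: "x \<in> U"
    have "diff_tangent_field Z x"
      using Z(1)[OF x] by (simp add: smooth_field_at_def smooth_near_imp_differentiable)
    then show "covd_N ?M c \<phi> g F X Z x \<in> normal_complement_N ?M c \<phi> g F T_snd x"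
      by (rule covd_N_in_normal_complement[where Z = Z and X = X and x = x, OF slant C _ Z(2)[OF x] X(2)[OF x]])
  qed
qed

end
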